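(* Let $(q,p)\in H^2$ and let $a$ in the unit sphere of $\mathcal H_{sp}$ be such that $(q,p,\pi_a)$ is a stationary point of the Hamiltonian system (with parameter $h$). Then $$\Big[H_{ph}+h\sum_{\lambda=1}^N\sum_{m=1}^3(\beta_m+B_m(x_\lambda))\langle\sigma_m^{[\lambda]}a,a\rangle\Big]\Psi_{(q,p),h}=\mathbf H(q,p,\pi_a)\,\Psi_{(q,p),h}.$$ Suppose moreover that $\beta\ne0$ and let $E\subset\{1,\dots,N\}$. Then, for this $(q,p)$, one has, with a constant $C>0$ independent of $h\in(0,1)$, $$\big\|\big(H(h)-(2|E|-N)|\beta|h\big)\big(\Psi_{(q,p),h}\otimes a_E\big)\big\|\le C\,h^{3/2}.$$
   Context: Photon space. $H$ is the real Hilbert space of $f=(f_1,f_2,f_3):\mathbb R^3\to\mathbb R^3$ with $f_j\in L^2(\mathbb R^3)$ real valued and $k\cdot f(k)=0$ a.e., with $|f|^2=\sum_j\int|f_j(k)|^2dk$ and scalar product $\cdot$; $H_{\mathbb C}$ is its complexification; $\mathcal H_{ph}=\mathcal F_s(H_{\mathbb C})$ is the symmetric Fock space. $M$ is multiplication by $|k|$ in $H$, with domain $D(M)$. $\Phi_S(f)=2^{-1/2}(a(f)+a^*(f))$ is the Segal field ($a^*(f)$ creation operator, linear in $f\in H_{\mathbb C}$). $h>0$ is the semiclassical parameter and $H_{ph}=h\,d\Gamma(M)$. Coherent states: $\Psi_{(a,b),h}=\sum_{n\ge0}\frac{e^{-(|a|^2+|b|^2)/4h}}{(2h)^{n/2}\sqrt{n!}}(a+ib)^{\otimes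 n}$ for $(a,b)\in H^2$. Fields. $\chi\in\mathcal S(\mathbb R)$ is a fixed real-valued function vanishing near $0$; $(e_1,e_2,e_3)$ is the canonical basis of $\mathbb R^3$; $\wedge$ is the cross product. For $x\in\mathbb R^3$, $m=1,2,3$, $$a_m(x)(k)=\frac{\chi(|k|)|k|^{1/2}}{(2\pi)^{3/2}}\sin(k\cdot x)\frac{k\wedge e_m}{|k|},\qquad b_m(x)(k)=\frac{\chi(|k|)|k|^{1/2}}{(2\pi)^{3/2}}\cos(k\cdot x)\frac{k\wedge e_m}{|k|},$$ $B_m(x,q,p)=a_m(x)\cdot q+b_m(x)\cdot p$ for $(q,p)\in H^2$, and $B_m(x)=\sqrt h\,\Phi_S(a_m(x)+ib_m(x))$. Spins. $x_1,\dots,x_N\in\mathbb R^3$ and $\beta=(\beta_1,\beta_2,\beta_3)\in\mathbb R^3$ are fixed; $\mathcal H_{sp}=(\mathbb C^2)^{\otimes N}$; $\sigma_m^{[\lambda]}$ is the Pauli matrix $\sigma_m$ acting on the $\lambda$-th factor. $H(h)=H_{ph}\otimes I+h\sum_{\lambda=1}^N\sum_{j=1}^3(\beta_j+B_j(x_\lambda))\otimes\sigma_j^{[\lambda]}$. When $\beta\neq0$, unit vectors $b_0,b_1\in\mathbb C^2$ are chosen with $\sum_m\beta_m\sigma_mb_0=-|\beta|b_0$, $\sum_m\beta_m\sigma_mb_1=|\beta|b_1$; $a_E=a_1\otimes\cdots\otimes a_N$ with $a_j=b_1$ if $j\in E$, $a_j=b_0$ if $j\notin E$; $|E|$ is the cardinality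 of $E$. Classical system. $\mathcal G$ is the Lie algebra of $SU(2^N)=SU(\mathcal H_{sp})$ (traceless antihermitian maps), $\mathcal G^\star$ its dual; for a unit vector $a\in\mathcal H_{sp}$, $\pi_a\in\mathcal G^\star$ is defined by $\langle\pi_a,Y\rangle=i^{-1}\langle Ya,a\rangle$. The Hamiltonian function is $$\mathbf H(q,p,\omega)=\tfrac12\int_{\mathbb R^3}|k|(|q(k)|^2+|p(k)|^2)dk+h\sum_{\lambda,m}(\beta_m+B_m(x_\lambda,q,p))\langle\omega,i\sigma_m^{[\lambda]}\rangle .$$ The Hamiltonian system is $q'=Mp+h\sum_{\lambda,m}b_m(x_\lambda)\langle\omega,i\sigma_m^{[\lambda]}\rangle$, $p'=-Mq-h\sum_{\lambda,m}a_m(x_\lambda)\langle\omega,i\sigma_m^{[\lambda]}\rangle$, $\frac{d}{dt}\langle\omega,Y\rangle=\sum_{\lambda,m}(\beta_m+B_m(x_\lambda,q,p))\langle\omega,[i\sigma_m^{[\lambda]},Y]\rangle$ for all $Y\in\mathcal G$. A stationary (fixed) point is a point $(q,p,\omega)$, with $q,p\in D(M)$, at which the three right-hand sides vanish. *)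

theory Defs
  imports "HOL-Analysis.Analysis" "HOL-Combinatorics.Permutations"
begin

section \<open>Photon one-particle space\<close>

text \<open>
  Elements of L2 spaces are represented by Borel measurable representatives, and equality in
  the L2 spaces (and in the Fock space below) is equality almost everywhere.
\<close>

definition photon_space :: "(real^3 \<Rightarrow> real^3) set" where
  "photon_space = {f \<in> borel_measurable lborel.
     integrable lborel (\<lambda>k. (norm (f k))\<^sup>2) \<and> (AE k in lborel. k \<bullet> f k = 0)}"

definition photon_inner :: "(real^3 \<Rightarrow> real^3) \<Rightarrow> (real^3 \<Rightarrow> real^3) \<Rightarrow> real" where
  "photon_inner f g = (\<integral>k. f k \<bullet> g k \<partial>lborel)"

definition mult_norm :: "(real^3 \<Rightarrow> real^3) \<Rightarrow> (real^3 \<Rightarrow> real^3)" where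
  "mult_norm f = (\<lambda>k. norm k *\<^sub>R f k)"

definition dom_mult_norm :: "(real^3 \<Rightarrow> real^3) set" where
  "dom_mult_norm = {f \<in> photon_space. mult_norm f \<in> photon_space}"

text \<open>
  The element f + i g of the complexification, as a complex function of a momentum k and a
  component index j.
\<close>

type_synonym mode = "(real^3) \<times> 3"

definition cplx :: "(real^3 \<Rightarrow> real^3) \<Rightarrow> (real^3 \<Rightarrow> real^3) \<Rightarrow> mode \<Rightarrow> complex" where
  "cplx f g = (\<lambda>(k, j). Complex (f k $ j) (g k $ j))"

section \<open>Symmetric Fock space\<close>

text \<open>
  The n-fold symmetric tensor power of the complexified photon space is realised, through the
  usual identification of the n-fold tensor power of L2(X) with L2(X^n), as the space of
  square integrable functions of n modes which are symmetric and, in each of the n arguments,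
  transverse. The elementary tensor of f_0, ..., f_(n-1) is the function sending K to the
  product of the f_i (K i) over i < n.
\<close>

definition mode_measure :: "mode measure" where
  "mode_measure = lborel \<Otimes>\<^sub>M count_space UNIV"

definition modes_measure :: "nat \<Rightarrow> (nat \<Rightarrow> mode) measure" where
  "modes_measure n = PiM {..<n} (\<lambda>_. mode_measure)"

definition sector :: "nat \<Rightarrow> ((nat \<Rightarrow> mode) \<Rightarrow> complex) set" where
  "sector n = {\<psi> \<in> borel_measurable (modes_measure n).
     integrable (modes_measure n) (\<lambda>K. (cmod (\<psi> K))\<^sup>2) \<and>
     (\<forall>\<pi>. \<pi> permutes {..<n} \<longrightarrow> (AE K in modes_measure n. \<psi> (K \<circ> \<pi>) = \<psi> K)) \<and>
     (\<forall>i<n. AE K in modes_measure n.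
        (\<Sum>j\<in>UNIV. complex_of_real (fst (K i) $ j) * \<psi> (K(i := (fst (K i), j)))) = 0)}"

type_synonym fock = "nat \<Rightarrow> (nat \<Rightarrow> mode) \<Rightarrow> complex"

definition fock_space :: "fock set" where
  "fock_space = {\<Psi>. (\<forall>n. \<Psi> n \<in> sector n) \<and>
     summable (\<lambda>n. \<integral>K. (cmod (\<Psi> n K))\<^sup>2 \<partial>modes_measure n)}"

definition fock_norm :: "fock \<Rightarrow> real" where
  "fock_norm \<Psi> = sqrt (\<Sum>n. \<integral>K. (cmod (\<Psi> n K))\<^sup>2 \<partial>modes_measure n)"

definition fock_eq :: "fock \<Rightarrow> fock \<Rightarrow> bool" where
  "fock_eq \<Psi> \<Phi> \<longleftrightarrow> (\<forall>n. AE K in modes_measure n. \<Psi> n K = \<Phi> n K)"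

definition fock_scale :: "complex \<Rightarrow> fock \<Rightarrow> fock" where
  "fock_scale c \<Psi> = (\<lambda>n K. c * \<Psi> n K)"

text \<open>
  \<open>drop_mode n i K\<close> removes the i-th of n modes. The creation operator is the usual
  sqrt n times the symmetrisation of the tensor product of f with the (n-1)-particle component,
  the symmetrisation being the average over the position of the argument of f.
\<close>

definition drop_mode :: "nat \<Rightarrow> nat \<Rightarrow> (nat \<Rightarrow> mode) \<Rightarrow> (nat \<Rightarrow> mode)" where
  "drop_mode n i K = (\<lambda>j\<in>{..<n - 1}. K (if j < i then j else Suc j))"

definition creation :: "(mode \<Rightarrow> complex) \<Rightarrow> fock \<Rightarrow> fock" where
  "creation f \<Psi> = (\<lambda>n K. (\<Sum>i<n. f (K i) * \<Psi> (n - 1) (drop_mode n i K)) / complex_of_real (sqrt (real n)))"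

definition annihilation :: "(mode \<Rightarrow> complex) \<Rightarrow> fock \<Rightarrow> fock" where
  "annihilation f \<Psi> = (\<lambda>n K. complex_of_real (sqrt (real (n + 1))) *
     (\<integral>z. cnj (f z) * \<Psi> (n + 1) (K(n := z)) \<partial>mode_measure))"

text \<open>
  The Segal field and the second quantisation are given sector by sector on their maximal
  domains; on these domains they are self-adjoint. For the Segal field this is the closure of
  its restriction to finite particle vectors.
\<close>

definition segal :: "(mode \<Rightarrow> complex) \<Rightarrow> fock \<Rightarrow> fock" where
  "segal f \<Psi> = (\<lambda>n K. (annihilation f \<Psi> n K + creation f \<Psi> n K) / complex_of_real (sqrt 2))"

definition dGamma_norm :: "fock \<Rightarrow> fock" where
  "dGamma_norm \<Psi> = (\<lambda>n K. complex_of_real (\<Sum>i<n. norm (fst (K i))) * \<Psi> n K)"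

definition H_ph :: "real \<Rightarrow> fock \<Rightarrow> fock" where
  "H_ph h \<Psi> = fock_scale (complex_of_real h) (dGamma_norm \<Psi>)"

definition op_dom :: "(fock \<Rightarrow> fock) \<Rightarrow> fock set" where
  "op_dom A = {\<Psi> \<in> fock_space. A \<Psi> \<in> fock_space}"

definition coherent :: "real \<Rightarrow> (real^3 \<Rightarrow> real^3) \<Rightarrow> (real^3 \<Rightarrow> real^3) \<Rightarrow> fock" where
  "coherent h a b = (\<lambda>n K.
     complex_of_real (exp (- (photon_inner a a + photon_inner b b) / (4 * h))
       / ((2 * h) powr (real n / 2) * sqrt (fact n)))
     * (\<Prod>i<n. cplx a b (K i)))"

section \<open>Fields\<close>

definition schwartz :: "(real \<Rightarrow> real) \<Rightarrow> bool" where
  "schwartz f \<longleftrightarrow>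
     (\<forall>n r. (deriv ^^ n) f differentiable (at r)) \<and>
     (\<forall>m n. bounded (range (\<lambda>r. r ^ m * (deriv ^^ n) f r)))"

definition a_field :: "(real \<Rightarrow> real) \<Rightarrow> real^3 \<Rightarrow> 3 \<Rightarrow> (real^3 \<Rightarrow> real^3)" where
  "a_field chi x m = (\<lambda>k.
     (chi (norm k) * sqrt (norm k) / (2 * pi) powr (3/2) * sin (k \<bullet> x)) *\<^sub>R
     (cross3 k (axis m 1) /\<^sub>R norm k))"

definition b_field :: "(real \<Rightarrow> real) \<Rightarrow> real^3 \<Rightarrow> 3 \<Rightarrow> (real^3 \<Rightarrow> real^3)" where
  "b_field chi x m = (\<lambda>k.
     (chi (norm k) * sqrt (norm k) / (2 * pi) powr (3/2) * cos (k \<bullet> x)) *\<^sub>R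
     (cross3 k (axis m 1) /\<^sub>R norm k))"

definition B_cl :: "(real \<Rightarrow> real) \<Rightarrow> real^3 \<Rightarrow> 3 \<Rightarrow> (real^3 \<Rightarrow> real^3) \<Rightarrow> (real^3 \<Rightarrow> real^3) \<Rightarrow> real" where
  "B_cl chi x m q p = photon_inner (a_field chi x m) q + photon_inner (b_field chi x m) p"

definition B_op :: "(real \<Rightarrow> real) \<Rightarrow> real \<Rightarrow> real^3 \<Rightarrow> 3 \<Rightarrow> fock \<Rightarrow> fock" where
  "B_op chi h x m \<Psi> = fock_scale (complex_of_real (sqrt h))
     (segal (cplx (a_field chi x m) (b_field chi x m)) \<Psi>)"

section \<open>Spins\<close>

text \<open>
  The sites are indexed by a finite type \<open>'n\<close> with N elements, and the N-fold tensor power of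
  C^2 is the space of complex functions of a spin configuration \<open>'n \<Rightarrow> 2\<close>; linear maps of this
  space are matrices.
\<close>

type_synonym 'n spin_vec = "complex^('n \<Rightarrow> 2)"
type_synonym 'n spin_mat = "complex^('n \<Rightarrow> 2)^('n \<Rightarrow> 2)"

definition spin_inner :: "'n::finite spin_vec \<Rightarrow> 'n spin_vec \<Rightarrow> complex" where
  "spin_inner u v = (\<Sum>s\<in>UNIV. u $ s * cnj (v $ s))"

definition spin_tensor :: "('n::finite \<Rightarrow> complex^2) \<Rightarrow> 'n spin_vec" where
  "spin_tensor v = (\<chi> s. \<Prod>l\<in>UNIV. v l $ s l)"

definition pauli :: "3 \<Rightarrow> complex^2^2" where
  "pauli m = (if m = 1 then vector [vector [0, 1], vector [1, 0]]
     else if m = 2 then vector [vector [0, - \<i>], vector [\<i>, 0]]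
     else vector [vector [1, 0], vector [0, - 1]])"

definition pauli_at :: "3 \<Rightarrow> 'n::finite \<Rightarrow> 'n spin_mat" where
  "pauli_at m l = (\<chi> s t. if \<forall>l'. l' \<noteq> l \<longrightarrow> s l' = t l' then pauli m $ s l $ t l else 0)"

definition i_pauli_at :: "3 \<Rightarrow> 'n::finite \<Rightarrow> 'n spin_mat" where
  "i_pauli_at m l = map_matrix (\<lambda>z. \<i> * z) (pauli_at m l)"

text \<open>\<open>a_E\<close> for the chosen eigenvectors \<open>b0\<close>, \<open>b1\<close>.\<close>

definition spin_conf_vec :: "complex^2 \<Rightarrow> complex^2 \<Rightarrow> 'n::finite set \<Rightarrow> 'n spin_vec" where
  "spin_conf_vec b0 b1 E = spin_tensor (\<lambda>l. if l \<in> E then b1 else b0)"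

section \<open>Photons coupled to spins\<close>

text \<open>
  Vectors of the tensor product of Fock space with the (finite dimensional) spin space are given
  by their Fock space valued coordinates in the canonical basis of the spin space.
\<close>

type_synonym 'n full = "('n \<Rightarrow> 2) \<Rightarrow> fock"

definition full_norm :: "'n::finite full \<Rightarrow> real" where
  "full_norm \<Phi> = sqrt (\<Sum>s\<in>UNIV. (fock_norm (\<Phi> s))\<^sup>2)"

definition full_tensor :: "fock \<Rightarrow> 'n::finite spin_vec \<Rightarrow> 'n full" where
  "full_tensor \<Psi> v = (\<lambda>s. fock_scale (v $ s) \<Psi>)"

definition op_tensor :: "(fock \<Rightarrow> fock) \<Rightarrow> 'n::finite spin_mat \<Rightarrow> 'n full \<Rightarrow> 'n full" where
  "op_tensor A S \<Phi> = (\<lambda>s n K. \<Sum>t\<in>UNIV. S $ s $ t * A (\<Phi> t) n K)"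

text \<open>
  \<open>sum_dom\<close> is the natural domain of a sum of \<open>H_ph\<close> and all the fields \<open>B_m(x_l)\<close>, i.e. the
  intersection of the domains of the summands.
\<close>

definition sum_dom :: "(real \<Rightarrow> real) \<Rightarrow> ('n::finite \<Rightarrow> real^3) \<Rightarrow> real \<Rightarrow> fock set" where
  "sum_dom chi x h = op_dom (H_ph h) \<inter> (\<Inter>l. \<Inter>m. op_dom (B_op chi h (x l) m))"

definition averaged_op ::
    "(real \<Rightarrow> real) \<Rightarrow> ('n::finite \<Rightarrow> real^3) \<Rightarrow> real^3 \<Rightarrow> real \<Rightarrow> 'n spin_vec \<Rightarrow> fock \<Rightarrow> fock" where
  "averaged_op chi x \<beta> h a \<Psi> = (\<lambda>n K. H_ph h \<Psi> n K +
     complex_of_real h * (\<Sum>l\<in>UNIV. \<Sum>m\<in>UNIV.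
       (complex_of_real (\<beta> $ m) * \<Psi> n K + B_op chi h (x l) m \<Psi> n K)
       * spin_inner (pauli_at m l *v a) a))"

definition full_hamiltonian ::
    "(real \<Rightarrow> real) \<Rightarrow> ('n::finite \<Rightarrow> real^3) \<Rightarrow> real^3 \<Rightarrow> real \<Rightarrow> 'n full \<Rightarrow> 'n full" where
  "full_hamiltonian chi x \<beta> h \<Phi> = (\<lambda>s n K. op_tensor (H_ph h) (mat 1) \<Phi> s n K +
     complex_of_real h * (\<Sum>l\<in>UNIV. \<Sum>j\<in>UNIV.
       op_tensor (\<lambda>\<Psi> n K. complex_of_real (\<beta> $ j) * \<Psi> n K + B_op chi h (x l) j \<Psi> n K)
         (pauli_at j l) \<Phi> s n K))"

definition dom_full_hamiltonian ::
    "(real \<Rightarrow> real) \<Rightarrow> ('n::finite \<Rightarrow> real^3) \<Rightarrow> real \<Rightarrow> 'n full set" where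
  "dom_full_hamiltonian chi x h = {\<Phi>. \<forall>s. \<Phi> s \<in> sum_dom chi x h}"

section \<open>Classical system\<close>

definition spin_lie :: "'n::finite spin_mat set" where
  "spin_lie = {Y. trace Y = 0 \<and> (\<forall>s t. cnj (Y $ t $ s) = - (Y $ s $ t))}"

definition spin_lie_dual :: "('n::finite spin_mat \<Rightarrow> real) set" where
  "spin_lie_dual = {\<omega>. \<forall>Y\<in>spin_lie. \<forall>Z\<in>spin_lie. \<forall>c d.
     \<omega> (c *\<^sub>R Y + d *\<^sub>R Z) = c * \<omega> Y + d * \<omega> Z}"

definition commutator :: "'n::finite spin_mat \<Rightarrow> 'n spin_mat \<Rightarrow> 'n spin_mat" where
  "commutator Y Z = Y ** Z - Z ** Y"

text \<open>For Y in \<open>spin_lie\<close> the complex number below is real; \<open>Re\<close> only adjusts the type.\<close>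

definition pi_fun :: "'n::finite spin_vec \<Rightarrow> 'n spin_mat \<Rightarrow> real" where
  "pi_fun a Y = Re (inverse \<i> * spin_inner (Y *v a) a)"

definition hamiltonian_fun ::
    "(real \<Rightarrow> real) \<Rightarrow> ('n::finite \<Rightarrow> real^3) \<Rightarrow> real^3 \<Rightarrow> real
     \<Rightarrow> (real^3 \<Rightarrow> real^3) \<Rightarrow> (real^3 \<Rightarrow> real^3) \<Rightarrow> ('n spin_mat \<Rightarrow> real) \<Rightarrow> real" where
  "hamiltonian_fun chi x \<beta> h q p \<omega> =
     1/2 * (\<integral>k. norm k * ((norm (q k))\<^sup>2 + (norm (p k))\<^sup>2) \<partial>lborel)
     + h * (\<Sum>l\<in>UNIV. \<Sum>m\<in>UNIV. (\<beta> $ m + B_cl chi (x l) m q p) * \<omega> (i_pauli_at m l))"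

definition stationary ::
    "(real \<Rightarrow> real) \<Rightarrow> ('n::finite \<Rightarrow> real^3) \<Rightarrow> real^3 \<Rightarrow> real
     \<Rightarrow> (real^3 \<Rightarrow> real^3) \<Rightarrow> (real^3 \<Rightarrow> real^3) \<Rightarrow> ('n spin_mat \<Rightarrow> real) \<Rightarrow> bool" where
  "stationary chi x \<beta> h q p \<omega> \<longleftrightarrow>
     q \<in> dom_mult_norm \<and> p \<in> dom_mult_norm \<and> \<omega> \<in> spin_lie_dual \<and>
     (AE k in lborel. mult_norm p k +
        h *\<^sub>R (\<Sum>l\<in>UNIV. \<Sum>m\<in>UNIV. \<omega> (i_pauli_at m l) *\<^sub>R b_field chi (x l) m k) = 0) \<and>
     (AE k in lborel. - mult_norm q k -
        h *\<^sub>R (\<Sum>l\<in>UNIV. \<Sum>m\<in>UNIV. \<omega> (i_pauli_at m l) *\<^sub>R a_field chi (x l) m k) = 0) \<and>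
     (\<forall>Y\<in>spin_lie. (\<Sum>l\<in>UNIV. \<Sum>m\<in>UNIV.
        (\<beta> $ m + B_cl chi (x l) m q p) * \<omega> (commutator (i_pauli_at m l) Y)) = 0)"

end

(*
  Up to normalisation, a coherent state is an exponential vector e(z) with n-particle components
  z (x) ... (x) z / sqrt(n!) and z = (q + ip) / sqrt(2h). On exponential vectors a(f) acts as the
  scalar <f, z> and dGamma(M) e(z) = a*(Mz) e(z). The first two equations of stationarity say that
  Mz = - sqrt(h/2) F, where F is the sum of the coupling functions weighted by the spin
  expectations. Hence H_ph cancels the creation part of the averaged field, and what remains is
  a scalar; it is real and equal to the energy because <F, z> is a negative multiple of <Mz, z>.
  For the second part a_E diagonalises the magnetic term, so every spin component of the residual
  has the form c e(z) + a*(g) e(z). Since Mz, and by the infrared cutoff also z, is O(sqrt h),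
  uniformly in the spin state, c and g are O(h^(3/2)), and |a*(g) e(z)|^2 <= |g|^2 (1 + |z|^2) exp |z|^2.
*)
theory Submission
  imports Defs "HOL-Probability.Sinc_Integral"
begin

section \<open>The one-particle space\<close>

text \<open>The pieces of the residual are estimated separately. The field terms carry the factor
  \<open>h * sqrt (h / 2)\<close>, which already has the required order once z is bounded; the term
  h Mz reaches it only because Mz is of order sqrt h. The other issue is uniformity: q, p and the
  spin state may vary with h, so every bound has to come from data fixed beforehand. The spin state
  enters only through expectations of Pauli matrices, which are bounded on the unit sphere, and the
  factor exp |z|^2 is cancelled by the squared normalisation of the coherent state. With
  unnormalised exponential vectors the operator formulas hold at every point. In those computations
  null sets enter only through the two photon equations of stationarity, and are lifted from one
  mode to n modes by the product measure.\<close>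

definition one_particle :: "(mode \<Rightarrow> complex) set" where
  "one_particle = {f \<in> borel_measurable mode_measure.
     integrable mode_measure (\<lambda>z. (cmod (f z))\<^sup>2) \<and>
     (AE z in mode_measure. (\<Sum>j\<in>UNIV. complex_of_real (fst z $ j) * f (fst z, j)) = 0)}"

definition normsq :: "(mode \<Rightarrow> complex) \<Rightarrow> real" where
  "normsq f = (\<integral>z. (cmod (f z))\<^sup>2 \<partial>mode_measure)"

definition mode_inner :: "(mode \<Rightarrow> complex) \<Rightarrow> (mode \<Rightarrow> complex) \<Rightarrow> complex" where
  "mode_inner f g = (\<integral>z. cnj (f z) * g z \<partial>mode_measure)"

interpretation momentum_index: pair_sigma_finite "lborel :: (real^3) measure" "count_space UNIV :: 3 measure"
  by (intro pair_sigma_finite.intro lborel.sigma_finite_measure_axioms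
      sigma_finite_measure_count_space_finite) simp

lemma sigma_finite_mode_measure: "sigma_finite_measure mode_measure"
  unfolding mode_measure_def by (rule momentum_index.P.sigma_finite_measure_axioms)

interpretation modes: product_sigma_finite "\<lambda>_::nat. mode_measure"
  by (intro product_sigma_finite.intro sigma_finite_mode_measure)

lemma space_mode_measure [simp]: "space mode_measure = UNIV"
  by (simp add: mode_measure_def space_pair_measure)

lemma borel_measurable_mode:
  fixes f :: "mode \<Rightarrow> 'b::topological_space"
  assumes [measurable]: "\<And>j. (\<lambda>k. f (k, j)) \<in> borel_measurable lborel"
  shows "f \<in> borel_measurable mode_measure"
proof -
  have "(\<lambda>z. f (fst z, snd z)) \<in> borel_measurable (lborel \<Otimes>\<^sub>M count_space UNIV)"
    by (rule measurable_compose_countable'[where I = UNIV and g = snd and f = "\<lambda>j z. f (fst z, j)"])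
      (auto simp: countable_finite)
  then show ?thesis
    by (simp add: mode_measure_def)
qed

lemma AE_mode_fst:
  assumes "AE k in lborel. P k"
  shows "AE z in mode_measure. P (fst z)"
proof -
  from assms obtain N where N: "{k. \<not> P k} \<subseteq> N" "N \<in> sets lborel" "emeasure lborel N = 0"
    by (auto elim!: AE_E)
  have "N \<times> (UNIV :: 3 set) \<in> null_sets mode_measure"
    using N by (intro null_setsI)
      (auto simp: mode_measure_def momentum_index.M2.emeasure_pair_measure_Times)
  then show ?thesis
    using N(1) by (auto intro!: AE_I'[of "N \<times> UNIV"])
qed

text \<open>The component index runs over three points with counting measure, so Fubini reduces
  integrability to single components and turns the inner integral into a finite sum, the scalar
  product of vector fields.\<close>

lemma integrable_modeI:
  fixes f :: "mode \<Rightarrow> 'b::{banach, second_countable_topology}"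
  assumes "\<And>j. integrable lborel (\<lambda>k. f (k, j))"
  shows "integrable mode_measure f"
    and "integral\<^sup>L mode_measure f = (\<integral>k. (\<Sum>j\<in>UNIV. f (k, j)) \<partial>lborel)"
proof -
  have meas: "f \<in> borel_measurable (lborel \<Otimes>\<^sub>M count_space UNIV)"
    using borel_measurable_mode[OF borel_measurable_integrable[OF assms]] by (simp add: mode_measure_def)
  have "integrable (lborel \<Otimes>\<^sub>M count_space UNIV) (\<lambda>(k, j). f (k, j))"
  proof (rule momentum_index.Fubini_integrable)
    show "(\<lambda>(k, j). f (k, j)) \<in> borel_measurable (lborel \<Otimes>\<^sub>M count_space UNIV)"
      using meas by simp
    show "integrable lborel (\<lambda>k. \<integral>j. norm (case (k, j) of (k, j) \<Rightarrow> f (k, j)) \<partial>count_space UNIV)"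
      by (auto simp: lebesgue_integral_count_space_finite intro!: assms)
    show "AE k in lborel. integrable (count_space UNIV) (\<lambda>j. case (k, j) of (k, j) \<Rightarrow> f (k, j))"
      by (simp add: integrable_count_space)
  qed
  then have int: "integrable (lborel \<Otimes>\<^sub>M count_space UNIV) f" by simp
  then show "integrable mode_measure f"
    by (simp add: mode_measure_def)
  show "integral\<^sup>L mode_measure f = (\<integral>k. (\<Sum>j\<in>UNIV. f (k, j)) \<partial>lborel)"
    using momentum_index.integral_fst'[OF int]
    by (simp add: mode_measure_def lebesgue_integral_count_space_finite)
qed

lemma one_particleD:
  assumes "f \<in> one_particle"
  shows "f \<in> borel_measurable mode_measure" "integrable mode_measure (\<lambda>z. (cmod (f z))\<^sup>2)"
    "AE z in mode_measure. (\<Sum>j\<in>UNIV. complex_of_real (fst z $ j) * f (fst z, j)) = 0"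
  using assms by (auto simp: one_particle_def)

lemma cmod_sum_le_Cauchy:
  "(cmod (\<Sum>i\<in>I. c i * f i))\<^sup>2 \<le> (\<Sum>i\<in>I. (cmod (c i))\<^sup>2) * (\<Sum>i\<in>I. (cmod (f i))\<^sup>2)"
proof -
  have "cmod (\<Sum>i\<in>I. c i * f i) \<le> (\<Sum>i\<in>I. cmod (c i) * cmod (f i))"
    by (metis (no_types, lifting) norm_mult norm_sum sum.cong)
  then have "(cmod (\<Sum>i\<in>I. c i * f i))\<^sup>2 \<le> (\<Sum>i\<in>I. cmod (c i) * cmod (f i))\<^sup>2"
    by (rule power_mono) simp
  also have "\<dots> \<le> (\<Sum>i\<in>I. (cmod (c i))\<^sup>2) * (\<Sum>i\<in>I. (cmod (f i))\<^sup>2)"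
    by (rule Cauchy_Schwarz_ineq_sum)
  finally show ?thesis .
qed

lemma mult_le_sum_squares: "0 \<le> x \<Longrightarrow> 0 \<le> y \<Longrightarrow> x * y \<le> x\<^sup>2 + y\<^sup>2" for x y :: real
  using sum_squares_bound[of x y] mult_nonneg_nonneg[of x y] by linarith

lemma cmod_add_square_le: "(cmod (u + v))\<^sup>2 \<le> 2 * (cmod u)\<^sup>2 + 2 * (cmod v)\<^sup>2"
proof -
  have "(cmod (u + v))\<^sup>2 \<le> (cmod u + cmod v)\<^sup>2"
    by (intro power_mono norm_triangle_ineq) simp
  also have "\<dots> \<le> 2 * (cmod u)\<^sup>2 + 2 * (cmod v)\<^sup>2"
    using sum_squares_bound[of "cmod u" "cmod v"] by (simp add: power2_sum)
  finally show ?thesis .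
qed

lemma normsq_nonneg [simp]: "0 \<le> normsq f"
  by (simp add: normsq_def)

lemma
  assumes f: "f \<in> one_particle"
  shows one_particle_scale: "(\<lambda>z. c * f z) \<in> one_particle"
    and normsq_scale: "normsq (\<lambda>z. c * f z) = (cmod c)\<^sup>2 * normsq f"
proof -
  note [measurable] = one_particleD(1)[OF f]
  have "AE z in mode_measure. (\<Sum>j\<in>UNIV. complex_of_real (fst z $ j) * (c * f (fst z, j))) = 0"
    using one_particleD(3)[OF f]
  proof eventually_elim
    case (elim z)
    have "(\<Sum>j\<in>UNIV. complex_of_real (fst z $ j) * (c * f (fst z, j)))
        = c * (\<Sum>j\<in>UNIV. complex_of_real (fst z $ j) * f (fst z, j))"
      by (simp add: sum_distrib_left algebra_simps)
    then show ?case by (simp add: elim)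
  qed
  then show "(\<lambda>z. c * f z) \<in> one_particle"
    using one_particleD(2)[OF f] by (auto simp: one_particle_def norm_mult power_mult_distrib)
  show "normsq (\<lambda>z. c * f z) = (cmod c)\<^sup>2 * normsq f"
    by (simp add: normsq_def norm_mult power_mult_distrib)
qed

lemma
  assumes f: "f \<in> one_particle" and g: "g \<in> one_particle"
  shows one_particle_add: "(\<lambda>z. f z + g z) \<in> one_particle"
    and normsq_add_le: "normsq (\<lambda>z. f z + g z) \<le> 2 * normsq f + 2 * normsq g"
proof -
  note [measurable] = one_particleD(1)[OF f] one_particleD(1)[OF g]
  note int = one_particleD(2)[OF f] one_particleD(2)[OF g]
  have 1: "integrable mode_measure (\<lambda>z. (cmod (f z + g z))\<^sup>2)"
    by (rule Bochner_Integration.integrable_bound[where f = "\<lambda>z. 2 * (cmod (f z))\<^sup>2 + 2 * (cmod (g z))\<^sup>2"])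
      (use int cmod_add_square_le in auto)
  have "AE z in mode_measure. (\<Sum>j\<in>UNIV. complex_of_real (fst z $ j) * (f (fst z, j) + g (fst z, j))) = 0"
    using one_particleD(3)[OF f] one_particleD(3)[OF g]
    by eventually_elim (simp add: distrib_left sum.distrib)
  then show "(\<lambda>z. f z + g z) \<in> one_particle"
    using 1 by (auto simp: one_particle_def)
  have "normsq (\<lambda>z. f z + g z) \<le> (\<integral>z. 2 * (cmod (f z))\<^sup>2 + 2 * (cmod (g z))\<^sup>2 \<partial>mode_measure)"
    unfolding normsq_def by (intro integral_mono 1) (use int cmod_add_square_le in auto)
  also have "\<dots> = 2 * normsq f + 2 * normsq g"
    using int by (simp add: normsq_def)
  finally show "normsq (\<lambda>z. f z + g z) \<le> 2 * normsq f + 2 * normsq g" .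
qed

lemma one_particle_zero: "(\<lambda>_. 0) \<in> one_particle"
  by (simp add: one_particle_def)

lemma one_particle_sum:
  assumes "\<And>i. i \<in> I \<Longrightarrow> f i \<in> one_particle"
  shows "(\<lambda>z. \<Sum>i\<in>I. c i * f i z) \<in> one_particle"
  using assms
  by (induction I rule: infinite_finite_induct)
    (auto intro!: one_particle_add one_particle_scale one_particle_zero)

lemma normsq_sum_le:
  assumes f: "\<And>i. i \<in> I \<Longrightarrow> f i \<in> one_particle"
  shows "normsq (\<lambda>z. \<Sum>i\<in>I. c i * f i z) \<le> (\<Sum>i\<in>I. (cmod (c i))\<^sup>2) * (\<Sum>i\<in>I. normsq (f i))"
proof -
  note int = one_particleD(2)[OF f]
  have "normsq (\<lambda>z. \<Sum>i\<in>I. c i * f i z)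
      \<le> (\<integral>z. (\<Sum>i\<in>I. (cmod (c i))\<^sup>2) * (\<Sum>i\<in>I. (cmod (f i z))\<^sup>2) \<partial>mode_measure)"
    unfolding normsq_def
    by (intro integral_mono one_particleD(2)[OF one_particle_sum] f cmod_sum_le_Cauchy
        integrable_mult_right Bochner_Integration.integrable_sum int)
  also have "\<dots> = (\<Sum>i\<in>I. (cmod (c i))\<^sup>2) * (\<Sum>i\<in>I. normsq (f i))"
    using int by (simp add: normsq_def)
  finally show ?thesis .
qed

text \<open>The pointwise inequality \<open>x * y \<le> x^2 + y^2\<close> replaces the
  Cauchy-Schwarz inequality in L2. A sum of squares is weaker than a product of norms, but the final
  estimate asks of a scalar product only a bound that does not depend on \<open>h\<close>.\<close>

lemma
  assumes f: "f \<in> one_particle" and g: "g \<in> one_particle"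
  shows integrable_mode_inner: "integrable mode_measure (\<lambda>z. cnj (f z) * g z)"
    and cmod_mode_inner_le: "cmod (mode_inner f g) \<le> normsq f + normsq g"
proof -
  note [measurable] = one_particleD(1)[OF f] one_particleD(1)[OF g]
  note int = one_particleD(2)[OF f] one_particleD(2)[OF g]
  have [measurable]: "cnj \<in> borel_measurable borel"
    by (intro borel_measurable_continuous_onI continuous_intros)
  have meas: "(\<lambda>z. cnj (f z) * g z) \<in> borel_measurable mode_measure"
    by measurable
  have le: "cmod (cnj (f z) * g z) \<le> (cmod (f z))\<^sup>2 + (cmod (g z))\<^sup>2" for z
    by (simp add: norm_mult mult_le_sum_squares)
  show 1: "integrable mode_measure (\<lambda>z. cnj (f z) * g z)"
    by (rule Bochner_Integration.integrable_bound[where f = "\<lambda>z. (cmod (f z))\<^sup>2 + (cmod (g z))\<^sup>2"])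
      (use int le meas in auto)
  have "cmod (mode_inner f g) \<le> (\<integral>z. (cmod (f z))\<^sup>2 + (cmod (g z))\<^sup>2 \<partial>mode_measure)"
    unfolding mode_inner_def using int le 1
    by (intro order_trans[OF integral_norm_bound integral_mono]) auto
  also have "\<dots> = normsq f + normsq g"
    using int by (simp add: normsq_def)
  finally show "cmod (mode_inner f g) \<le> normsq f + normsq g" .
qed

lemma mode_inner_scale_right: "mode_inner f (\<lambda>z. c * g z) = c * mode_inner f g"
proof -
  have "(\<lambda>z. cnj (f z) * (c * g z)) = (\<lambda>z. c * (cnj (f z) * g z))"
    by (simp add: algebra_simps)
  then show ?thesis by (simp add: mode_inner_def)
qed

section \<open>Photon space and its complexification\<close>

lemma photon_spaceD:
  assumes "f \<in> photon_space"
  shows "f \<in> borel_measurable borel" "integrable lborel (\<lambda>k. (norm (f k))\<^sup>2)"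
    "AE k in lborel. k \<bullet> f k = 0"
  using assms by (auto simp: photon_space_def)

lemma integrable_inner_photon:
  assumes f: "f \<in> photon_space" and g: "g \<in> photon_space"
  shows "integrable lborel (\<lambda>k. f k \<bullet> g k)"
proof (rule Bochner_Integration.integrable_bound[where f = "\<lambda>k. (norm (f k))\<^sup>2 + (norm (g k))\<^sup>2"])
  note [measurable] = photon_spaceD(1)[OF f] photon_spaceD(1)[OF g]
  show "integrable lborel (\<lambda>k. (norm (f k))\<^sup>2 + (norm (g k))\<^sup>2)"
    using photon_spaceD(2)[OF f] photon_spaceD(2)[OF g] by simp
  show "(\<lambda>k. f k \<bullet> g k) \<in> borel_measurable lborel"
    by measurable
  have "\<bar>u \<bullet> v\<bar> \<le> (norm u)\<^sup>2 + (norm v)\<^sup>2" for u v :: "real^3"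
    using Cauchy_Schwarz_ineq2[of u v] mult_le_sum_squares[of "norm u" "norm v"] by simp
  then show "AE k in lborel. norm (f k \<bullet> g k) \<le> norm ((norm (f k))\<^sup>2 + (norm (g k))\<^sup>2)"
    by simp
qed

lemma integrable_component_mult:
  assumes f: "f \<in> photon_space" and g: "g \<in> photon_space"
  shows "integrable lborel (\<lambda>k. f k $ j * g k $ j)"
proof (rule Bochner_Integration.integrable_bound[where f = "\<lambda>k. (norm (f k))\<^sup>2 + (norm (g k))\<^sup>2"])
  note [measurable] = photon_spaceD(1)[OF f] photon_spaceD(1)[OF g]
  show "integrable lborel (\<lambda>k. (norm (f k))\<^sup>2 + (norm (g k))\<^sup>2)"
    using photon_spaceD(2)[OF f] photon_spaceD(2)[OF g] by simp
  have [measurable]: "(\<lambda>v. v $ j) \<in> borel_measurable (borel :: (real^3) measure)"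
    by (intro borel_measurable_continuous_onI continuous_intros)
  show "(\<lambda>k. f k $ j * g k $ j) \<in> borel_measurable lborel"
    by measurable
  have "\<bar>u $ j * v $ j\<bar> \<le> (norm u)\<^sup>2 + (norm v)\<^sup>2" for u v :: "real^3"
  proof -
    have "\<bar>u $ j * v $ j\<bar> \<le> norm u * norm v"
      unfolding abs_mult by (intro mult_mono component_le_norm_cart) auto
    then show ?thesis
      using mult_le_sum_squares[of "norm u" "norm v"] by simp
  qed
  then show "AE k in lborel. norm (f k $ j * g k $ j) \<le> norm ((norm (f k))\<^sup>2 + (norm (g k))\<^sup>2)"
    by simp
qed

text \<open>Since \<open>mode_inner\<close> is antilinear in its first slot, the real part is the
  scalar product of pairs and the imaginary part their symplectic form. For \<open>f\<close>,
  \<open>g\<close> the coupling functions \<open>a_field\<close>, \<open>b_field\<close>, the real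
  part is the classical field \<open>B_cl\<close>.\<close>

lemma
  assumes f: "f \<in> photon_space" and g: "g \<in> photon_space" and q: "q \<in> photon_space" and p: "p \<in> photon_space"
  shows mode_inner_cplx: "mode_inner (cplx f g) (cplx q p)
      = Complex (photon_inner f q + photon_inner g p) (photon_inner f p - photon_inner g q)"
    and integrable_cplx_mult: "integrable mode_measure (\<lambda>z. cnj (cplx f g z) * cplx q p z)"
proof -
  note comp = integrable_component_mult[OF f q] integrable_component_mult[OF f p]
    integrable_component_mult[OF g q] integrable_component_mult[OF g p]
  have e: "cnj (cplx f g (k, j)) * cplx q p (k, j) =
      complex_of_real (f k $ j * q k $ j + g k $ j * p k $ j)
      + \<i> * complex_of_real (f k $ j * p k $ j - g k $ j * q k $ j)" for k j
    by (simp add: cplx_def complex_eq_iff)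
  have int: "integrable lborel (\<lambda>k. cnj (cplx f g (k, j)) * cplx q p (k, j))" for j
    unfolding e using comp
    by (intro Bochner_Integration.integrable_add integrable_mult_right integrable_of_real
        Bochner_Integration.integrable_diff)
  show "integrable mode_measure (\<lambda>z. cnj (cplx f g z) * cplx q p z)"
    using int by (rule integrable_modeI)
  have "mode_inner (cplx f g) (cplx q p) = (\<integral>k. (\<Sum>j\<in>UNIV. cnj (cplx f g (k, j)) * cplx q p (k, j)) \<partial>lborel)"
    unfolding mode_inner_def by (rule integrable_modeI(2)[OF int])
  also have "(\<lambda>k. \<Sum>j\<in>UNIV. cnj (cplx f g (k, j)) * cplx q p (k, j)) = (\<lambda>k.
      complex_of_real (f k \<bullet> q k + g k \<bullet> p k) + \<i> * complex_of_real (f k \<bullet> p k - g k \<bullet> q k))"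
    by (simp add: e inner_vec_def sum.distrib sum_subtractf flip: sum_distrib_left)
  also have "(\<integral>k. complex_of_real (f k \<bullet> q k + g k \<bullet> p k) + \<i> * complex_of_real (f k \<bullet> p k - g k \<bullet> q k) \<partial>lborel)
    = complex_of_real (\<integral>k. f k \<bullet> q k + g k \<bullet> p k \<partial>lborel) + \<i> * complex_of_real (\<integral>k. f k \<bullet> p k - g k \<bullet> q k \<partial>lborel)"
    using integrable_inner_photon f g q p
    by (subst Bochner_Integration.integral_add)
      (auto intro!: integrable_of_real integrable_mult_right
        simp only: integral_complex_of_real integral_mult_right_zero)
  also have "\<dots> = Complex (photon_inner f q + photon_inner g p) (photon_inner f p - photon_inner g q)"
    using integrable_inner_photon f g q p by (simp add: photon_inner_def complex_eq_iff)
  finally show "mode_inner (cplx f g) (cplx q p)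
      = Complex (photon_inner f q + photon_inner g p) (photon_inner f p - photon_inner g q)" .
qed

lemma
  assumes f: "f \<in> photon_space" and g: "g \<in> photon_space"
  shows cplx_one_particle: "cplx f g \<in> one_particle"
    and normsq_cplx: "normsq (cplx f g) = photon_inner f f + photon_inner g g"
proof -
  \<comment> \<open>Written as a product with the conjugate, the squared modulus makes both
    integrability and the norm the diagonal case of the preceding lemma.\<close>
  have sq: "(\<lambda>z. complex_of_real ((cmod (cplx f g z))\<^sup>2)) = (\<lambda>z. cnj (cplx f g z) * cplx f g z)"
    by (simp only: complex_norm_square mult.commute)
  have "integrable mode_measure (\<lambda>z. complex_of_real ((cmod (cplx f g z))\<^sup>2))"
    unfolding sq by (rule integrable_cplx_mult[OF f g f g])
  then have int: "integrable mode_measure (\<lambda>z. (cmod (cplx f g z))\<^sup>2)"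
    by (simp only: complex_of_real_integrable_eq)
  note [measurable] = photon_spaceD(1)[OF f] photon_spaceD(1)[OF g]
  have [measurable]: "(\<lambda>v. v $ j) \<in> borel_measurable (borel :: (real^3) measure)" for j
    by (intro borel_measurable_continuous_onI continuous_intros)
  have "(\<lambda>k. complex_of_real (f k $ j) + \<i> * complex_of_real (g k $ j)) \<in> borel_measurable lborel" for j
    by measurable
  then have meas: "cplx f g \<in> borel_measurable mode_measure"
    by (intro borel_measurable_mode) (simp add: cplx_def Complex_eq)
  have "AE z in mode_measure. fst z \<bullet> f (fst z) = 0 \<and> fst z \<bullet> g (fst z) = 0"
    by (rule AE_mode_fst) (use photon_spaceD(3)[OF f] photon_spaceD(3)[OF g] in auto)
  then have "AE z in mode_measure. (\<Sum>j\<in>UNIV. complex_of_real (fst z $ j) * cplx f g (fst z, j)) = 0"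
  proof eventually_elim
    case (elim z)
    have "(\<Sum>j\<in>UNIV. complex_of_real (fst z $ j) * cplx f g (fst z, j))
        = Complex (fst z \<bullet> f (fst z)) (fst z \<bullet> g (fst z))"
      by (simp add: cplx_def inner_vec_def complex_eq_iff)
    then show ?case using elim by (simp add: complex_eq_iff)
  qed
  then show "cplx f g \<in> one_particle"
    using int meas by (simp add: one_particle_def)
  have "complex_of_real (normsq (cplx f g)) = mode_inner (cplx f g) (cplx f g)"
    unfolding normsq_def mode_inner_def integral_complex_of_real[symmetric] sq ..
  then show "normsq (cplx f g) = photon_inner f f + photon_inner g g"
    by (simp add: mode_inner_cplx f g complex_eq_iff)
qed

section \<open>Exponential vectors in Fock space\<close>

definition exp_vec :: "(mode \<Rightarrow> complex) \<Rightarrow> fock" where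
  "exp_vec z = (\<lambda>n K. (\<Prod>i<n. z (K i)) / complex_of_real (sqrt (fact n)))"

text \<open>The exceptional set lies in a box whose i-th side is the null set. The other sides have
  infinite measure, but a single factor 0 makes the product 0.\<close>

lemma AE_modes_component:
  assumes "AE z in mode_measure. P z" and i: "i < n"
  shows "AE K in modes_measure n. P (K i)"
proof -
  from assms(1) obtain N where N: "{z. \<not> P z} \<subseteq> N" "N \<in> sets mode_measure" "emeasure mode_measure N = 0"
    by (auto elim!: AE_E)
  let ?A = "\<lambda>j. if j = i then N else space mode_measure"
  have sets: "\<And>j. ?A j \<in> sets mode_measure"
    using N(2) sets.top[of mode_measure] by auto
  have "emeasure (modes_measure n) (Pi\<^sub>E {..<n} ?A) = (\<Prod>j<n. emeasure mode_measure (?A j))"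
    unfolding modes_measure_def by (rule modes.emeasure_PiM) (use sets in auto)
  also have "\<dots> = 0"
    using i N(3) by (auto intro!: prod_zero bexI[of _ i])
  finally have "Pi\<^sub>E {..<n} ?A \<in> null_sets (modes_measure n)"
    using sets by (intro null_setsI) (auto simp: modes_measure_def intro!: sets_PiM_I_finite)
  then show ?thesis
    by (rule AE_I') (use N(1) i in \<open>auto simp: modes_measure_def space_PiM PiE_def Pi_def extensional_def\<close>)
qed

lemma measurable_mode_component:
  "f \<in> borel_measurable mode_measure \<Longrightarrow> i < n \<Longrightarrow> (\<lambda>K. f (K i)) \<in> borel_measurable (modes_measure n)"
  unfolding modes_measure_def
  by (rule measurable_compose[OF measurable_component_singleton]) auto

lemma
  assumes u: "\<And>i. i < n \<Longrightarrow> u i \<in> one_particle"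
  shows borel_measurable_tensor: "(\<lambda>K. \<Prod>i<n. u i (K i)) \<in> borel_measurable (modes_measure n)"
    and integrable_tensor: "integrable (modes_measure n) (\<lambda>K. (cmod (\<Prod>i<n. u i (K i)))\<^sup>2)"
    and integral_tensor: "(\<integral>K. (cmod (\<Prod>i<n. u i (K i)))\<^sup>2 \<partial>modes_measure n) = (\<Prod>i<n. normsq (u i))"
proof -
  show "(\<lambda>K. \<Prod>i<n. u i (K i)) \<in> borel_measurable (modes_measure n)"
    by (intro borel_measurable_prod measurable_mode_component one_particleD u) auto
  have eq: "(\<lambda>K. (cmod (\<Prod>i<n. u i (K i)))\<^sup>2) = (\<lambda>K. \<Prod>i<n. (cmod (u i (K i)))\<^sup>2)"
    by (simp add: prod_norm[symmetric] prod_power_distrib)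
  show "integrable (modes_measure n) (\<lambda>K. (cmod (\<Prod>i<n. u i (K i)))\<^sup>2)"
    unfolding eq modes_measure_def
    by (rule modes.product_integrable_prod[where f = "\<lambda>i w. (cmod (u i w))\<^sup>2"]) (use u one_particleD(2) in auto)
  show "(\<integral>K. (cmod (\<Prod>i<n. u i (K i)))\<^sup>2 \<partial>modes_measure n) = (\<Prod>i<n. normsq (u i))"
    unfolding eq modes_measure_def normsq_def
    by (rule modes.product_integral_prod[where f = "\<lambda>i w. (cmod (u i w))\<^sup>2"]) (use u one_particleD(2) in auto)
qed

text \<open>Changing the component index of the l-th mode affects only the l-th factor; the
  remaining product leaves the sum over components, where transversality of \<open>u l\<close>
  applies.\<close>

lemma tensor_transverse:
  assumes u: "\<And>i. i < n \<Longrightarrow> u i \<in> one_particle" and l: "l < n"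
  shows "AE K in modes_measure n. (\<Sum>j\<in>UNIV. complex_of_real (fst (K l) $ j) *
    (\<Prod>i<n. u i ((K(l := (fst (K l), j))) i))) = 0"
  using AE_modes_component[OF one_particleD(3)[OF u[OF l]] l]
proof eventually_elim
  case (elim K)
  have "(\<Prod>i<n. u i ((K(l := w)) i)) = u l w * (\<Prod>i\<in>{..<n} - {l}. u i (K i))" for w
    using l by (subst prod.remove[of _ l]) auto
  then have "(\<Sum>j\<in>UNIV. complex_of_real (fst (K l) $ j) * (\<Prod>i<n. u i ((K(l := (fst (K l), j))) i)))
    = (\<Sum>j\<in>UNIV. complex_of_real (fst (K l) $ j) * u l (fst (K l), j)) * (\<Prod>i\<in>{..<n} - {l}. u i (K i))"
    by (simp only: sum_distrib_right mult.assoc)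
  then show ?case
    using elim by simp
qed

lemma cmod_sum_square_le: "(cmod (\<Sum>i\<in>I. f i))\<^sup>2 \<le> real (card I) * (\<Sum>i\<in>I. (cmod (f i))\<^sup>2)"
  using cmod_sum_le_Cauchy[of "\<lambda>_. 1" f I] by simp

text \<open>The terms are not symmetric one by one, so symmetry is asked of the sum only. The two
  uses are a single product, for exponential vectors, and the sum over the n possible places of one
  distinguished factor, for creation operators. The factor \<open>card R\<close> comes from
  Cauchy-Schwarz over the terms, in place of computing their mutual scalar products.\<close>

lemma
  assumes u: "\<And>r i. r \<in> R \<Longrightarrow> i < n \<Longrightarrow> u r i \<in> one_particle"
    and sym: "\<And>\<pi> K. \<pi> permutes {..<n} \<Longrightarrow>
      (\<Sum>r\<in>R. \<Prod>i<n. u r i (K (\<pi> i))) = (\<Sum>r\<in>R. \<Prod>i<n. u r i (K i))"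
  shows sector_tensor_sum: "(\<lambda>K. \<Sum>r\<in>R. \<Prod>i<n. u r i (K i)) \<in> sector n"
    and integral_tensor_sum_le: "(\<integral>K. (cmod (\<Sum>r\<in>R. \<Prod>i<n. u r i (K i)))\<^sup>2 \<partial>modes_measure n)
      \<le> real (card R) * (\<Sum>r\<in>R. \<Prod>i<n. normsq (u r i))"
proof -
  let ?\<psi> = "\<lambda>K. \<Sum>r\<in>R. \<Prod>i<n. u r i (K i)"
  have meas: "?\<psi> \<in> borel_measurable (modes_measure n)"
    by (intro borel_measurable_sum borel_measurable_tensor u)
  have bound: "integrable (modes_measure n) (\<lambda>K. real (card R) * (\<Sum>r\<in>R. (cmod (\<Prod>i<n. u r i (K i)))\<^sup>2))"
    by (intro integrable_mult_right Bochner_Integration.integrable_sum integrable_tensor u)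
  have int: "integrable (modes_measure n) (\<lambda>K. (cmod (?\<psi> K))\<^sup>2)"
    by (rule Bochner_Integration.integrable_bound[OF bound])
      (use meas cmod_sum_square_le in \<open>auto simp: abs_mult sum_nonneg\<close>)
  have trans: "AE K in modes_measure n.
      (\<Sum>j\<in>UNIV. complex_of_real (fst (K l) $ j) * ?\<psi> (K(l := (fst (K l), j)))) = 0" if l: "l < n" for l
  proof (cases "finite R")
    case True
    have "AE K in modes_measure n. \<forall>r\<in>R. (\<Sum>j\<in>UNIV. complex_of_real (fst (K l) $ j) *
        (\<Prod>i<n. u r i ((K(l := (fst (K l), j))) i))) = 0"
      using True by (intro AE_finite_allI tensor_transverse u l)
    then show ?thesis
    proof eventually_elim
      case (elim K)
      have "(\<Sum>j\<in>UNIV. complex_of_real (fst (K l) $ j) * ?\<psi> (K(l := (fst (K l), j))))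
        = (\<Sum>r\<in>R. \<Sum>j\<in>UNIV. complex_of_real (fst (K l) $ j) * (\<Prod>i<n. u r i ((K(l := (fst (K l), j))) i)))"
        unfolding sum_distrib_left by (rule sum.swap)
      also have "\<dots> = 0"
        using elim by (intro sum.neutral) blast
      finally show ?case .
    qed
  qed simp
  show "?\<psi> \<in> sector n"
    using meas int trans sym by (simp add: sector_def o_def)
  have "(\<integral>K. (cmod (?\<psi> K))\<^sup>2 \<partial>modes_measure n)
      \<le> (\<integral>K. real (card R) * (\<Sum>r\<in>R. (cmod (\<Prod>i<n. u r i (K i)))\<^sup>2) \<partial>modes_measure n)"
    by (intro integral_mono int bound cmod_sum_square_le)
  also have "\<dots> = real (card R) * (\<Sum>r\<in>R. \<Prod>i<n. normsq (u r i))"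
    using integrable_tensor[OF u] integral_tensor[OF u] by simp
  finally show "(\<integral>K. (cmod (?\<psi> K))\<^sup>2 \<partial>modes_measure n) \<le> real (card R) * (\<Sum>r\<in>R. \<Prod>i<n. normsq (u r i))" .
qed

section \<open>Linear structure of the sectors and of Fock space\<close>

lemma sectorD:
  assumes "\<psi> \<in> sector n"
  shows "\<psi> \<in> borel_measurable (modes_measure n)" "integrable (modes_measure n) (\<lambda>K. (cmod (\<psi> K))\<^sup>2)"
    "\<pi> permutes {..<n} \<Longrightarrow> AE K in modes_measure n. \<psi> (K \<circ> \<pi>) = \<psi> K"
    "i < n \<Longrightarrow> AE K in modes_measure n.
        (\<Sum>j\<in>UNIV. complex_of_real (fst (K i) $ j) * \<psi> (K(i := (fst (K i), j)))) = 0"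
  using assms by (auto simp: sector_def)

lemma sector_scale:
  assumes \<psi>: "\<psi> \<in> sector n"
  shows "(\<lambda>K. c * \<psi> K) \<in> sector n"
proof -
  note [measurable] = sectorD(1)[OF \<psi>]
  have sym: "AE K in modes_measure n. c * \<psi> (K \<circ> \<pi>) = c * \<psi> K" if "\<pi> permutes {..<n}" for \<pi>
    using sectorD(3)[OF \<psi> that] by eventually_elim simp
  have trans: "AE K in modes_measure n.
      (\<Sum>j\<in>UNIV. complex_of_real (fst (K l) $ j) * (c * \<psi> (K(l := (fst (K l), j))))) = 0" if "l < n" for l
    using sectorD(4)[OF \<psi> that]
    by eventually_elim (simp add: mult.left_commute[of _ c] flip: sum_distrib_left)
  show ?thesis
    using sectorD(2)[OF \<psi>] sym trans by (simp add: sector_def norm_mult power_mult_distrib)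
qed

lemma
  assumes \<psi>: "\<psi> \<in> sector n" and \<phi>: "\<phi> \<in> sector n"
  shows sector_add: "(\<lambda>K. \<psi> K + \<phi> K) \<in> sector n"
    and integral_sector_add_le: "(\<integral>K. (cmod (\<psi> K + \<phi> K))\<^sup>2 \<partial>modes_measure n)
      \<le> 2 * (\<integral>K. (cmod (\<psi> K))\<^sup>2 \<partial>modes_measure n) + 2 * (\<integral>K. (cmod (\<phi> K))\<^sup>2 \<partial>modes_measure n)"
proof -
  note [measurable] = sectorD(1)[OF \<psi>] sectorD(1)[OF \<phi>]
  note int = sectorD(2)[OF \<psi>] sectorD(2)[OF \<phi>]
  have sym: "AE K in modes_measure n. \<psi> (K \<circ> \<pi>) + \<phi> (K \<circ> \<pi>) = \<psi> K + \<phi> K"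
    if "\<pi> permutes {..<n}" for \<pi>
    using sectorD(3)[OF \<psi> that] sectorD(3)[OF \<phi> that] by eventually_elim simp
  have trans: "AE K in modes_measure n. (\<Sum>j\<in>UNIV. complex_of_real (fst (K l) $ j) *
      (\<psi> (K(l := (fst (K l), j))) + \<phi> (K(l := (fst (K l), j))))) = 0" if "l < n" for l
    using sectorD(4)[OF \<psi> that] sectorD(4)[OF \<phi> that]
    by eventually_elim (simp add: distrib_left sum.distrib)
  have bound: "integrable (modes_measure n) (\<lambda>K. 2 * (cmod (\<psi> K))\<^sup>2 + 2 * (cmod (\<phi> K))\<^sup>2)"
    using int by simp
  have int': "integrable (modes_measure n) (\<lambda>K. (cmod (\<psi> K + \<phi> K))\<^sup>2)"
    by (rule Bochner_Integration.integrable_bound[OF bound]) (use cmod_add_square_le in auto)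
  then show "(\<lambda>K. \<psi> K + \<phi> K) \<in> sector n"
    using sym trans by (simp add: sector_def)
  have "(\<integral>K. (cmod (\<psi> K + \<phi> K))\<^sup>2 \<partial>modes_measure n)
      \<le> (\<integral>K. 2 * (cmod (\<psi> K))\<^sup>2 + 2 * (cmod (\<phi> K))\<^sup>2 \<partial>modes_measure n)"
    by (intro integral_mono int' bound cmod_add_square_le)
  then show "(\<integral>K. (cmod (\<psi> K + \<phi> K))\<^sup>2 \<partial>modes_measure n)
      \<le> 2 * (\<integral>K. (cmod (\<psi> K))\<^sup>2 \<partial>modes_measure n) + 2 * (\<integral>K. (cmod (\<phi> K))\<^sup>2 \<partial>modes_measure n)"
    using int by simp
qed

lemma fock_spaceD:
  assumes "\<Psi> \<in> fock_space"
  shows "\<Psi> n \<in> sector n" "summable (\<lambda>n. \<integral>K. (cmod (\<Psi> n K))\<^sup>2 \<partial>modes_measure n)"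
  using assms by (auto simp: fock_space_def)

lemma fock_norm_square:
  assumes "\<Psi> \<in> fock_space"
  shows "(fock_norm \<Psi>)\<^sup>2 = (\<Sum>n. \<integral>K. (cmod (\<Psi> n K))\<^sup>2 \<partial>modes_measure n)"
  unfolding fock_norm_def
  by (intro real_sqrt_pow2 suminf_nonneg fock_spaceD[OF assms]) simp

lemma
  assumes \<Psi>: "\<Psi> \<in> fock_space"
  shows fock_space_scale: "fock_scale c \<Psi> \<in> fock_space"
    and fock_norm_scale: "(fock_norm (fock_scale c \<Psi>))\<^sup>2 = (cmod c)\<^sup>2 * (fock_norm \<Psi>)\<^sup>2"
proof -
  have eq: "(\<lambda>n. \<integral>K. (cmod (fock_scale c \<Psi> n K))\<^sup>2 \<partial>modes_measure n)
      = (\<lambda>n. (cmod c)\<^sup>2 * (\<integral>K. (cmod (\<Psi> n K))\<^sup>2 \<partial>modes_measure n))"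
    by (simp add: fock_scale_def norm_mult power_mult_distrib)
  have sector: "fock_scale c \<Psi> n \<in> sector n" for n
    using sector_scale[OF fock_spaceD(1)[OF \<Psi>]] by (simp add: fock_scale_def)
  show mem: "fock_scale c \<Psi> \<in> fock_space"
    unfolding fock_space_def using fock_spaceD(2)[OF \<Psi>] sector
    by (simp only: eq mem_Collect_eq summable_mult simp_thms)
  show "(fock_norm (fock_scale c \<Psi>))\<^sup>2 = (cmod c)\<^sup>2 * (fock_norm \<Psi>)\<^sup>2"
    unfolding fock_norm_square[OF mem] fock_norm_square[OF \<Psi>] eq
    by (rule suminf_mult) (rule fock_spaceD(2)[OF \<Psi>])
qed

lemma
  assumes \<Psi>: "\<Psi> \<in> fock_space" and \<Phi>: "\<Phi> \<in> fock_space"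
  shows fock_space_add: "(\<lambda>n K. \<Psi> n K + \<Phi> n K) \<in> fock_space"
    and fock_norm_add_le: "(fock_norm (\<lambda>n K. \<Psi> n K + \<Phi> n K))\<^sup>2 \<le> 2 * (fock_norm \<Psi>)\<^sup>2 + 2 * (fock_norm \<Phi>)\<^sup>2"
proof -
  let ?I = "\<lambda>\<Psi> n. \<integral>K. (cmod (\<Psi> n K))\<^sup>2 \<partial>modes_measure n"
  have le: "?I (\<lambda>n K. \<Psi> n K + \<Phi> n K) n \<le> 2 * ?I \<Psi> n + 2 * ?I \<Phi> n" for n
    by (rule integral_sector_add_le) (intro fock_spaceD \<Psi> \<Phi>)+
  have sm: "summable (\<lambda>n. 2 * ?I \<Psi> n + 2 * ?I \<Phi> n)"
    by (intro summable_add summable_mult fock_spaceD(2) \<Psi> \<Phi>)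
  have sm': "summable (?I (\<lambda>n K. \<Psi> n K + \<Phi> n K))"
    by (rule summable_comparison_test'[OF sm, of 0]) (use le in simp)
  show mem: "(\<lambda>n K. \<Psi> n K + \<Phi> n K) \<in> fock_space"
    using sm' sector_add[OF fock_spaceD(1)[OF \<Psi>] fock_spaceD(1)[OF \<Phi>]] by (simp add: fock_space_def)
  have "(fock_norm (\<lambda>n K. \<Psi> n K + \<Phi> n K))\<^sup>2 \<le> (\<Sum>n. 2 * ?I \<Psi> n + 2 * ?I \<Phi> n)"
    unfolding fock_norm_square[OF mem] by (rule suminf_le[OF le sm' sm])
  also have "\<dots> = 2 * (fock_norm \<Psi>)\<^sup>2 + 2 * (fock_norm \<Phi>)\<^sup>2"
    unfolding fock_norm_square[OF \<Psi>] fock_norm_square[OF \<Phi>]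
    by (simp add: suminf_add[symmetric] suminf_mult fock_spaceD(2) \<Psi> \<Phi> summable_mult)
  finally show "(fock_norm (\<lambda>n K. \<Psi> n K + \<Phi> n K))\<^sup>2 \<le> 2 * (fock_norm \<Psi>)\<^sup>2 + 2 * (fock_norm \<Phi>)\<^sup>2" .
qed

section \<open>Norms of exponential vectors and of their images under creation operators\<close>

lemma exp_sums_divide: "(\<lambda>n. Z ^ n / fact n) sums exp Z" for Z :: real
  using exp_converges[of Z] by (simp add: divide_inverse mult.commute)

lemma
  assumes z: "z \<in> one_particle"
  shows exp_vec_fock_space: "exp_vec z \<in> fock_space"
    and fock_norm_exp_vec: "(fock_norm (exp_vec z))\<^sup>2 = exp (normsq z)"
proof -
  have sector: "exp_vec z n \<in> sector n" for n
  proof -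
    have "(\<Prod>i<n. z (K (\<pi> i))) = (\<Prod>i<n. z (K i))" if "\<pi> permutes {..<n}" for \<pi> K
      using prod.permute[OF that, of "\<lambda>i. z (K i)"] by (simp add: o_def)
    \<comment> \<open>The one-point index set makes a single product an instance of the lemma on
      sums.\<close>
    then have "(\<lambda>K. \<Sum>r\<in>{()}. \<Prod>i<n. z (K i)) \<in> sector n"
      by (intro sector_tensor_sum) (use z in auto)
    then have "(\<lambda>K. (1 / complex_of_real (sqrt (fact n))) * (\<Prod>i<n. z (K i))) \<in> sector n"
      by (intro sector_scale) simp
    then show ?thesis by (simp add: exp_vec_def)
  qed
  have int: "(\<integral>K. (cmod (exp_vec z n K))\<^sup>2 \<partial>modes_measure n) = normsq z ^ n / fact n" for n
    using integral_tensor[of n "\<lambda>_. z"] z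
    by (simp add: exp_vec_def norm_divide power_divide)
  show mem: "exp_vec z \<in> fock_space"
    using sector exp_sums_divide[of "normsq z"] by (simp add: fock_space_def int sums_iff)
  show "(fock_norm (exp_vec z))\<^sup>2 = exp (normsq z)"
    unfolding fock_norm_square[OF mem] int by (rule sums_unique[OF exp_sums_divide, symmetric])
qed

text \<open>\<open>drop_mode\<close> closes the gap at \<open>i\<close> by shifting the later modes
  down by one, and a product does not see the relabelling.\<close>

lemma prod_drop_mode:
  assumes "i < Suc m"
  shows "(\<Prod>j<m. g (drop_mode (Suc m) i K j)) = (\<Prod>j\<in>{..<Suc m} - {i}. g (K j))"
  by (rule prod.reindex_bij_witness[where
        i = "\<lambda>j. if j < i then j else j - 1" and j = "\<lambda>j. if j < i then j else Suc j"])
    (use assms in \<open>auto simp: drop_mode_def\<close>)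

text \<open>The i-th term is the elementary tensor with \<open>f\<close> in place \<open>i\<close>
  and \<open>z\<close> in all others, encoded by a function update. The factor
  \<open>1 / sqrt n\<close> of the creation operator and \<open>1 / sqrt ((n - 1)!)\<close> of the
  exponential vector combine to \<open>1 / sqrt (n!)\<close>; for n = 0 both sums are empty.\<close>

lemma creation_exp_vec:
  "creation f (exp_vec z) n K =
    (\<Sum>i<n. \<Prod>j<n. ((\<lambda>_. z)(i := f)) j (K j)) / complex_of_real (sqrt (fact n))"
proof (cases n)
  case (Suc m)
  have "f (K i) * (\<Prod>j<m. z (drop_mode n i K j)) = (\<Prod>j<n. ((\<lambda>_. z)(i := f)) j (K j))" if "i < n" for i
    using that prod_drop_mode[of i m z K] Suc
    by (subst prod.remove[of _ i]) auto
  then have "(\<Sum>i<n. f (K i) * (\<Prod>j<m. z (drop_mode n i K j))) = (\<Sum>i<n. \<Prod>j<n. ((\<lambda>_. z)(i := f)) j (K j))"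
    by (intro sum.cong) auto
  then show ?thesis
    using Suc by (simp add: creation_def exp_vec_def real_sqrt_mult mult.commute flip: sum_divide_distrib
        del: sum.lessThan_Suc prod.lessThan_Suc)
qed (simp add: creation_def)

text \<open>The terms bound the squared norms of the components of a created exponential vector when
  \<open>Z = |z|^2\<close> and \<open>|f| = 1\<close>: one factor n counts the tensors, the other
  comes from Cauchy-Schwarz over them. An index shift and one cancellation in the factorial leave
  the series of \<open>(n + 1) Z^n / n!\<close>.\<close>

lemma sums_creation_bound:
  "(\<lambda>n. real n * (real n * (Z ^ (n - 1) / fact n))) sums ((1 + Z) * exp Z)" for Z :: real
proof -
  note e = exp_sums_divide[of Z]
  have "(\<lambda>n. real (Suc n) * (Z ^ Suc n / fact (Suc n))) = (\<lambda>n. Z * (Z ^ n / fact n))"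
    by (auto simp: fun_eq_iff divide_simps)
  then have "(\<lambda>n. real n * (Z ^ n / fact n)) sums (Z * exp Z)"
    using sums_mult[OF e, of Z] sums_Suc[of "\<lambda>n. real n * (Z ^ n / fact n)" "Z * exp Z"] by simp
  then have "(\<lambda>n. real n * (Z ^ n / fact n) + Z ^ n / fact n) sums (Z * exp Z + exp Z)"
    by (rule sums_add[OF _ e])
  moreover have "(\<lambda>n. real (Suc n) * (real (Suc n) * (Z ^ (Suc n - 1) / fact (Suc n))))
      = (\<lambda>n. real n * (Z ^ n / fact n) + Z ^ n / fact n)"
  proof
    fix n
    have "real (Suc n) * (Z ^ (Suc n - 1) / fact (Suc n)) = Z ^ n / fact n"
      by (simp add: fact_Suc del: of_nat_Suc)
    then have "real (Suc n) * (real (Suc n) * (Z ^ (Suc n - 1) / fact (Suc n))) = real (Suc n) * (Z ^ n / fact n)"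
      by (rule arg_cong)
    also have "\<dots> = real n * (Z ^ n / fact n) + Z ^ n / fact n"
      by (simp only: of_nat_Suc distrib_right mult_1_left add.commute)
    finally show "real (Suc n) * (real (Suc n) * (Z ^ (Suc n - 1) / fact (Suc n)))
        = real n * (Z ^ n / fact n) + Z ^ n / fact n" .
  qed
  ultimately show ?thesis
    using sums_Suc[of "\<lambda>n. real n * (real n * (Z ^ (n - 1) / fact n))" "Z * exp Z + exp Z"]
    by (simp add: algebra_simps)
qed

text \<open>The exact squared norm is \<open>(|f|^2 + |<f, z>|^2) exp |z|^2\<close>, which equals
  the bound when \<open>f\<close> is a multiple of \<open>z\<close>; the crude count of terms
  therefore costs little.\<close>

lemma
  assumes f: "f \<in> one_particle" and z: "z \<in> one_particle"
  shows creation_exp_vec_fock_space: "creation f (exp_vec z) \<in> fock_space"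
    and fock_norm_creation_exp_vec_le:
      "(fock_norm (creation f (exp_vec z)))\<^sup>2 \<le> normsq f * ((1 + normsq z) * exp (normsq z))"
proof -
  let ?u = "\<lambda>i. (\<lambda>_. z)(i := f)"
  let ?I = "\<lambda>n. \<integral>K. (cmod (creation f (exp_vec z) n K))\<^sup>2 \<partial>modes_measure n"
  let ?b = "\<lambda>n. normsq f * (real n * (real n * (normsq z ^ (n - 1) / fact n)))"
  have u: "?u i j \<in> one_particle" for i j
    using f z by simp
  have sym: "(\<Sum>i<n. \<Prod>j<n. ?u i j (K (\<pi> j))) = (\<Sum>i<n. \<Prod>j<n. ?u i j (K j))"
    if \<pi>: "\<pi> permutes {..<n}" for \<pi> n K
  proof -
    \<comment> \<open>A permutation of the arguments only moves the place of \<open>f\<close>.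
      Relabelling both the places and the arguments by the same permutation undoes this, since
      \<open>\<pi> j = \<pi> i\<close> exactly for \<open>j = i\<close>.\<close>
    have "(\<Sum>i<n. \<Prod>j<n. ?u i j (K j)) = (\<Sum>i<n. \<Prod>j<n. ?u (\<pi> i) j (K j))"
      using sum.permute[OF \<pi>, of "\<lambda>i. \<Prod>j<n. ?u i j (K j)"] by (simp only: o_def)
    also have "\<dots> = (\<Sum>i<n. \<Prod>j<n. ?u (\<pi> i) (\<pi> j) (K (\<pi> j)))"
      by (intro sum.cong refl) (rule prod.permute[OF \<pi>, unfolded o_def])
    also have "\<dots> = (\<Sum>i<n. \<Prod>j<n. ?u i j (K (\<pi> j)))"
      using permutes_inj[OF \<pi>] by (intro sum.cong prod.cong) (auto dest: injD)
    finally show ?thesis ..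
  qed
  note tensor = sector_tensor_sum[of "{..<n}" n ?u for n, OF u sym]
    integral_tensor_sum_le[of "{..<n}" n ?u for n, OF u sym]
  have sector: "creation f (exp_vec z) n \<in> sector n" for n
  proof -
    have "(\<lambda>K. (1 / complex_of_real (sqrt (fact n))) * (\<Sum>i<n. \<Prod>j<n. ?u i j (K j))) \<in> sector n"
      by (intro sector_scale tensor)
    moreover have "creation f (exp_vec z) n
        = (\<lambda>K. (1 / complex_of_real (sqrt (fact n))) * (\<Sum>i<n. \<Prod>j<n. ?u i j (K j)))"
      by (simp only: creation_exp_vec fun_eq_iff) simp
    ultimately show ?thesis by simp
  qed
  have le: "?I n \<le> ?b n" for n
  proof -
    have "(\<Prod>j<n. normsq (?u i j)) = normsq f * normsq z ^ (n - 1)" if "i < n" for i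
    proof -
      have "(\<Prod>j<n. normsq (?u i j)) = normsq f * (\<Prod>j\<in>{..<n} - {i}. normsq z)"
        using that by (subst prod.remove[of _ i]) auto
      then show ?thesis using that by simp
    qed
    then have "(\<Sum>i<n. \<Prod>j<n. normsq (?u i j)) = real n * (normsq f * normsq z ^ (n - 1))"
      by simp
    then have "(\<integral>K. (cmod (\<Sum>i<n. \<Prod>j<n. ?u i j (K j)))\<^sup>2 \<partial>modes_measure n)
        \<le> real n * (real n * (normsq f * normsq z ^ (n - 1)))"
      using tensor(2)[of n] by simp
    then have "(\<integral>K. (cmod (\<Sum>i<n. \<Prod>j<n. ?u i j (K j)))\<^sup>2 \<partial>modes_measure n) / fact n
        \<le> real n * (real n * (normsq f * normsq z ^ (n - 1))) / fact n"
      by (rule divide_right_mono) simp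
    moreover have "?I n = (\<integral>K. (cmod (\<Sum>i<n. \<Prod>j<n. ?u i j (K j)))\<^sup>2 \<partial>modes_measure n) / fact n"
      by (simp add: creation_exp_vec norm_divide power_divide)
    ultimately show ?thesis
      by (simp add: algebra_simps)
  qed
  have sb: "?b sums (normsq f * ((1 + normsq z) * exp (normsq z)))"
    by (intro sums_mult sums_creation_bound)
  have sm: "summable ?I"
    by (rule summable_comparison_test'[OF sums_summable[OF sb], of 0]) (use le in simp)
  show mem: "creation f (exp_vec z) \<in> fock_space"
    unfolding fock_space_def using sector sm by blast
  have "(\<Sum>n. ?I n) \<le> (\<Sum>n. ?b n)"
    by (rule suminf_le[OF le sm sums_summable[OF sb]])
  then show "(fock_norm (creation f (exp_vec z)))\<^sup>2 \<le> normsq f * ((1 + normsq z) * exp (normsq z))"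
    unfolding fock_norm_square[OF mem] using sums_unique[OF sb] by simp
qed

text \<open>At a given \<open>K\<close> the creation operator evaluates its function only at the n
  modes \<open>K i\<close>, so finitely many lifted null sets suffice. Through this lemma the photon
  equations, known only almost everywhere, enter Fock space.\<close>

lemma creation_exp_vec_cong_AE:
  assumes "AE w in mode_measure. f w = g w"
  shows "AE K in modes_measure n. creation f (exp_vec z) n K = creation g (exp_vec z) n K"
proof -
  have "AE K in modes_measure n. \<forall>i\<in>{..<n}. f (K i) = g (K i)"
    by (intro AE_finite_allI AE_modes_component assms) auto
  then show ?thesis
    by eventually_elim (auto simp: creation_def)
qed

section \<open>Linearity of the operators and their action on exponential vectors\<close>

lemma creation_sum:
  "creation (\<lambda>w. \<Sum>r\<in>R. c r * f r w) \<Psi> n K = (\<Sum>r\<in>R. c r * creation (f r) \<Psi> n K)"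
proof -
  have "(\<Sum>i<n. (\<Sum>r\<in>R. c r * f r (K i)) * \<Psi> (n - 1) (drop_mode n i K))
      = (\<Sum>r\<in>R. c r * (\<Sum>i<n. f r (K i) * \<Psi> (n - 1) (drop_mode n i K)))"
    unfolding sum_distrib_left sum_distrib_right by (subst sum.swap) (simp add: mult.assoc)
  then show ?thesis
    by (simp only: creation_def sum_divide_distrib[of _ R] times_divide_eq_right)
qed

lemma creation_add_left:
  "creation (\<lambda>w. f w + g w) \<Psi> n K = creation f \<Psi> n K + creation g \<Psi> n K"
  by (simp add: creation_def distrib_right sum.distrib add_divide_distrib)

lemma creation_scale_left: "creation (\<lambda>w. c * f w) \<Psi> n K = c * creation f \<Psi> n K"
  by (simp add: creation_def sum_distrib_left mult.assoc)

lemma creation_fock_scale: "creation f (fock_scale c \<Psi>) = fock_scale c (creation f \<Psi>)"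
  by (simp add: creation_def fock_scale_def sum_distrib_left mult.left_commute fun_eq_iff)

text \<open>A nonintegrable integrand has integral 0, and scaling by a nonzero constant leaves it
  nonintegrable, so the constant passes through the integral for every vector.\<close>

lemma annihilation_fock_scale: "annihilation f (fock_scale c \<Psi>) = fock_scale c (annihilation f \<Psi>)"
proof -
  have "(\<integral>w. cnj (f w) * (c * \<Psi> (n + 1) (K(n := w))) \<partial>mode_measure)
      = c * (\<integral>w. cnj (f w) * \<Psi> (n + 1) (K(n := w)) \<partial>mode_measure)" for n K
    by (simp only: mult.left_commute[of _ c] integral_mult_right_zero)
  then show ?thesis
    by (simp add: annihilation_def fock_scale_def mult.left_commute)
qed

lemma H_ph_fock_scale: "H_ph h (fock_scale c \<Psi>) = fock_scale c (H_ph h \<Psi>)"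
  by (simp add: H_ph_def dGamma_norm_def fock_scale_def mult.left_commute)

lemma B_op_fock_scale: "B_op chi h x m (fock_scale c \<Psi>) = fock_scale c (B_op chi h x m \<Psi>)"
  unfolding B_op_def segal_def creation_fock_scale annihilation_fock_scale
  by (simp add: fock_scale_def fun_eq_iff algebra_simps)

text \<open>Appending \<open>w\<close> as the mode with number n multiplies the product by
  \<open>z w\<close> and leaves the other factors alone, so the integral is the scalar product of
  \<open>f\<close> and \<open>z\<close>; then \<open>sqrt (n + 1) / sqrt ((n + 1)!)\<close> is
  \<open>1 / sqrt (n!)\<close>.\<close>

lemma annihilation_exp_vec:
  "annihilation f (exp_vec z) n K = mode_inner f z * exp_vec z n K"
proof -
  have "cnj (f w) * exp_vec z (n + 1) (K(n := w))
      = (cnj (f w) * z w) * ((\<Prod>i<n. z (K i)) / complex_of_real (sqrt (fact (n + 1))))" for w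
    by (simp add: exp_vec_def)
  then have "annihilation f (exp_vec z) n K = complex_of_real (sqrt (real (n + 1))) *
      (mode_inner f z * ((\<Prod>i<n. z (K i)) / complex_of_real (sqrt (fact (n + 1)))))"
    by (simp only: annihilation_def mode_inner_def integral_mult_left_zero)
  then show ?thesis
    by (simp add: exp_vec_def real_sqrt_mult)
qed

text \<open>The i-th momentum modulus can be absorbed into the i-th factor of the product. This puts
  Mz in place \<open>i\<close> and leaves \<open>z\<close> elsewhere, which is term by term the sum
  that creates Mz.\<close>

lemma dGamma_norm_exp_vec:
  "dGamma_norm (exp_vec z) = creation (\<lambda>w. complex_of_real (norm (fst w)) * z w) (exp_vec z)"
proof (intro ext)
  fix n :: nat and K
  let ?f = "\<lambda>w. complex_of_real (norm (fst w)) * z w"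
  have "(\<Prod>j<n. ((\<lambda>_. z)(i := ?f)) j (K j)) = complex_of_real (norm (fst (K i))) * (\<Prod>j<n. z (K j))"
    if "i < n" for i
    using that by (simp add: prod.remove[of "{..<n}" i, OF finite_lessThan] mult.assoc)
  then show "dGamma_norm (exp_vec z) n K = creation ?f (exp_vec z) n K"
    unfolding creation_exp_vec by (simp add: dGamma_norm_def exp_vec_def sum_distrib_right)
qed

definition coupling :: "(real \<Rightarrow> real) \<Rightarrow> real^3 \<Rightarrow> 3 \<Rightarrow> mode \<Rightarrow> complex" where
  "coupling chi x m = cplx (a_field chi x m) (b_field chi x m)"

lemma B_op_exp_vec:
  "B_op chi h x m (exp_vec z) n K =
    complex_of_real (sqrt h / sqrt 2) * 
      (mode_inner (coupling chi x m) z * exp_vec z n K + creation (coupling chi x m) (exp_vec z) n K)"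
  by (simp add: B_op_def fock_scale_def segal_def annihilation_exp_vec coupling_def)

lemma coherent_eq_exp_vec:
  assumes h: "h > 0"
  shows "coherent h a b = fock_scale (complex_of_real (exp (- (photon_inner a a + photon_inner b b) / (4 * h))))
    (exp_vec (\<lambda>w. complex_of_real (1 / sqrt (2 * h)) * cplx a b w))"
proof (intro ext)
  fix n :: nat and K
  have "(2 * h) powr (real n / 2) = sqrt (2 * h) ^ n"
    using h by (simp add: powr_half_sqrt[symmetric] powr_power mult.commute)
  then show "coherent h a b n K = fock_scale (complex_of_real (exp (- (photon_inner a a + photon_inner b b) / (4 * h))))
    (exp_vec (\<lambda>w. complex_of_real (1 / sqrt (2 * h)) * cplx a b w)) n K"
    by (simp add: coherent_def fock_scale_def exp_vec_def prod.distrib prod_dividef power_divide)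
qed

section \<open>The coupling functions\<close>

text \<open>An integrable majorant made to factorise over coordinates: Tonelli reduces it to the
  integral of \<open>1 / (1 + r^2)\<close> over the line and avoids polar coordinates.\<close>

lemma integrable_prod_inverse_1_plus_square:
  "integrable lborel (\<lambda>k::'a::euclidean_space. \<Prod>b\<in>Basis. inverse (1 + (k \<bullet> b)\<^sup>2))"
proof -
  have "integrable lborel (\<lambda>r::real. inverse (1 + r\<^sup>2))"
    using integrable_inverse_1_plus_square by (simp add: set_integrable_def)
  then have "(\<integral>\<^sup>+r. ennreal (inverse (1 + r\<^sup>2)) \<partial>(lborel :: real measure)) < \<infinity>"
    by (simp add: integrable_iff_bounded)
  moreover have "(\<integral>\<^sup>+k. ennreal (\<Prod>b\<in>Basis. inverse (1 + ((k::'a) \<bullet> b)\<^sup>2)) \<partial>lborel)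
      = (\<Prod>b\<in>(Basis::'a set). (\<integral>\<^sup>+r. ennreal (inverse (1 + r\<^sup>2)) \<partial>(lborel :: real measure)))"
    by (subst nn_integral_lborel_prod[symmetric]) (auto simp: prod_ennreal)
  ultimately have "(\<integral>\<^sup>+k. ennreal (\<Prod>b\<in>Basis. inverse (1 + ((k::'a) \<bullet> b)\<^sup>2)) \<partial>lborel) < \<infinity>"
    by (simp add: less_top power_less_top_ennreal)
  moreover have "norm (\<Prod>b\<in>Basis. inverse (1 + (k \<bullet> b)\<^sup>2)) = (\<Prod>b\<in>Basis. inverse (1 + (k \<bullet> b)\<^sup>2))" for k :: 'a
    by (simp add: prod_nonneg)
  ultimately show ?thesis
    by (simp add: integrable_iff_bounded)
qed

text \<open>Every coordinate is bounded by the norm. The exponent is the dimension because there is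
  one factor per coordinate; in momentum space this fixes the power 3 in the decay of
  \<open>chi\<close>.\<close>

lemma inverse_power_le_prod:
  fixes k :: "'a::euclidean_space"
  shows "inverse ((1 + (norm k)\<^sup>2) ^ DIM('a)) \<le> (\<Prod>b\<in>Basis. inverse (1 + (k \<bullet> b)\<^sup>2))"
proof -
  have "(\<Prod>b\<in>(Basis::'a set). 1 + (k \<bullet> b)\<^sup>2) \<le> (\<Prod>b\<in>(Basis::'a set). 1 + (norm k)\<^sup>2)"
  proof (rule prod_mono)
    fix b :: 'a assume "b \<in> Basis"
    then have "\<bar>k \<bullet> b\<bar> \<le> norm k"
      by (rule Basis_le_norm)
    then show "0 \<le> 1 + (k \<bullet> b)\<^sup>2 \<and> 1 + (k \<bullet> b)\<^sup>2 \<le> 1 + (norm k)\<^sup>2"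
      by (simp add: abs_le_square_iff[symmetric])
  qed
  then show ?thesis
    unfolding prod_inversef[of "\<lambda>b. 1 + (k \<bullet> b)\<^sup>2" Basis, unfolded o_def]
    by (intro le_imp_inverse_le) (auto intro!: prod_pos add_pos_nonneg)
qed

text \<open>The factor \<open>r\<close> is the square of the \<open>sqrt (norm k)\<close> in the
  fields, and the right-hand side is the decay that the product majorant on three-dimensional space
  dominates.\<close>

lemma schwartz_decay:
  assumes "schwartz chi"
  obtains C where "\<And>r. r \<ge> 0 \<Longrightarrow> (chi r)\<^sup>2 * r \<le> C * inverse ((1 + r\<^sup>2) ^ 3)"
proof -
  have bdd: "bounded (range (\<lambda>r. r ^ m * chi r))" for m
    using assms unfolding schwartz_def by (metis funpow_0)
  from bdd[of 0] obtain A where A: "\<And>r. \<bar>chi r\<bar> \<le> A"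
    by (auto simp: bounded_iff)
  \<comment> \<open>Power 4 is enough: \<open>(1 + r^4)^2\<close> controls
    \<open>(1 + r^2)^4\<close>, three powers of which give the decay while the last one absorbs
    \<open>r\<close>.\<close>
  from bdd[of 4] obtain B where B: "\<And>r. \<bar>r ^ 4 * chi r\<bar> \<le> B"
    by (auto simp: bounded_iff)
  have "(chi r)\<^sup>2 * r \<le> (4 * (A + B)\<^sup>2) * inverse ((1 + r\<^sup>2) ^ 3)" if r: "r \<ge> 0" for r
  proof -
    have "(1 + r ^ 4) * \<bar>chi r\<bar> \<le> A + B"
      using A[of r] B[of r] by (simp add: abs_mult algebra_simps)
    then have "((1 + r ^ 4) * \<bar>chi r\<bar>)\<^sup>2 \<le> (A + B)\<^sup>2"
      by (rule power_mono) simp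
    then have 1: "(1 + r ^ 4)\<^sup>2 * (chi r)\<^sup>2 \<le> (A + B)\<^sup>2"
      by (simp add: power_mult_distrib)
    have "(1 + r\<^sup>2)\<^sup>2 \<le> 2 * (1 + r ^ 4)"
      using zero_le_power2[of "1 - r\<^sup>2"] by (simp add: power2_eq_square power4_eq_xxxx algebra_simps)
    then have "((1 + r\<^sup>2)\<^sup>2)\<^sup>2 \<le> (2 * (1 + r ^ 4))\<^sup>2"
      by (rule power_mono) simp
    then have 2: "(1 + r\<^sup>2) ^ 4 \<le> 4 * (1 + r ^ 4)\<^sup>2"
      by (simp only: power_mult_distrib power_mult[symmetric]) simp
    have 3: "r \<le> 1 + r\<^sup>2"
      using zero_le_power2[of "r - 1"] r by (simp add: power2_eq_square algebra_simps)
    have "(chi r)\<^sup>2 * r * (1 + r\<^sup>2) ^ 3 \<le> (chi r)\<^sup>2 * (1 + r\<^sup>2) * (1 + r\<^sup>2) ^ 3"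
      using 3 by (intro mult_right_mono mult_left_mono) auto
    also have "\<dots> = (chi r)\<^sup>2 * (1 + r\<^sup>2) ^ 4"
      by (simp add: power_numeral_reduce)
    also have "\<dots> \<le> (chi r)\<^sup>2 * (4 * (1 + r ^ 4)\<^sup>2)"
      by (rule mult_left_mono[OF 2]) simp
    also have "\<dots> \<le> 4 * (A + B)\<^sup>2"
      using 1 by (simp add: mult.commute)
    finally have "(chi r)\<^sup>2 * r * (1 + r\<^sup>2) ^ 3 \<le> 4 * (A + B)\<^sup>2" .
    moreover have "(1 + r\<^sup>2) ^ 3 > 0"
      by (simp add: add_pos_nonneg)
    ultimately show ?thesis
      by (simp add: field_simps)
  qed
  then show ?thesis
    by (rule that)
qed

lemma schwartz_measurable:
  assumes "schwartz chi"
  shows "chi \<in> borel_measurable borel"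
proof (intro borel_measurable_continuous_onI continuous_at_imp_continuous_on ballI)
  fix r
  have "chi differentiable (at r)"
    using assms unfolding schwartz_def by (metis funpow_0)
  then show "isCont chi r"
    by (rule differentiable_imp_continuous_within)
qed

text \<open>This is the common form of \<open>a_field\<close> and \<open>b_field\<close>, with the
  sine or the cosine as \<open>s\<close>. A cross product with \<open>k\<close> is orthogonal to
  \<open>k\<close>, and after division by \<open>norm k\<close> it has norm at most 1, so only the
  radial decay of \<open>chi\<close> has to be integrated.\<close>

lemma radial_cutoff_photon_space:
  fixes s :: "real^3 \<Rightarrow> real"
  assumes chi: "schwartz chi" and [measurable]: "s \<in> borel_measurable borel" and s: "\<And>k. \<bar>s k\<bar> \<le> 1"
  shows "(\<lambda>k. (chi (norm k) * sqrt (norm k) / (2 * pi) powr (3/2) * s k) *\<^sub>R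
     (cross3 k (axis m 1) /\<^sub>R norm k)) \<in> photon_space" (is "?F \<in> _")
proof -
  note [measurable] = schwartz_measurable[OF chi]
  have [measurable]: "(\<lambda>k. cross3 k (axis m 1)) \<in> borel_measurable borel"
    by (intro borel_measurable_continuous_onI continuous_on_cross continuous_intros)
  have meas: "?F \<in> borel_measurable borel"
    by measurable
  obtain C where C: "\<And>r. r \<ge> 0 \<Longrightarrow> (chi r)\<^sup>2 * r \<le> C * inverse ((1 + r\<^sup>2) ^ 3)"
    using schwartz_decay[OF chi] by blast
  have C0: "C \<ge> 0"
    using C[of 0] by simp
  have le: "(norm (?F k))\<^sup>2 \<le> C * (\<Prod>b\<in>Basis. inverse (1 + (k \<bullet> b)\<^sup>2))" for k
  proof -
    have "norm (cross3 k (axis m 1) /\<^sub>R norm k) \<le> 1"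
    proof (cases "k = 0")
      case False
      have "(norm (cross3 k (axis m 1)))\<^sup>2 \<le> (norm k)\<^sup>2"
        using norm_cross[of k "axis m 1"] by (simp add: norm_axis_1)
      then have "norm (cross3 k (axis m 1)) \<le> norm k"
        by (rule power2_le_imp_le) simp
      then show ?thesis
        using False by (simp add: divide_simps)
    qed simp
    moreover have "\<bar>chi (norm k) * sqrt (norm k) / (2 * pi) powr (3/2) * s k\<bar> \<le> \<bar>chi (norm k) * sqrt (norm k)\<bar>"
    proof -
      \<comment> \<open>The normalising constant only makes the field smaller and is
        discarded.\<close>
      have "1 \<le> (2 * pi) powr (3/2)"
        using pi_gt3 by (intro ge_one_powr_ge_zero) auto
      then have "\<bar>y / (2 * pi) powr (3/2)\<bar> \<le> \<bar>y\<bar>" for y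
        by (simp add: divide_le_eq mult_le_cancel_left1)
      then have "\<bar>chi (norm k) * sqrt (norm k) / (2 * pi) powr (3/2)\<bar> * \<bar>s k\<bar> \<le> \<bar>chi (norm k) * sqrt (norm k)\<bar> * 1"
        by (intro mult_mono s) (auto simp only: abs_ge_zero)
      then show ?thesis
        by (simp add: abs_mult)
    qed
    ultimately have "norm (?F k) \<le> \<bar>chi (norm k) * sqrt (norm k)\<bar> * 1"
      unfolding norm_scaleR by (intro mult_mono) auto
    then have "(norm (?F k))\<^sup>2 \<le> (\<bar>chi (norm k) * sqrt (norm k)\<bar>)\<^sup>2"
      by (intro power_mono) auto
    also have "\<dots> = (chi (norm k))\<^sup>2 * norm k"
      by (simp add: power_mult_distrib)
    also have "\<dots> \<le> C * inverse ((1 + (norm k)\<^sup>2) ^ 3)"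
      by (rule C) simp
    also have "\<dots> \<le> C * (\<Prod>b\<in>Basis. inverse (1 + (k \<bullet> b)\<^sup>2))"
      using inverse_power_le_prod[of k] C0 by (intro mult_left_mono) auto
    finally show ?thesis .
  qed
  have "integrable lborel (\<lambda>k. (norm (?F k))\<^sup>2)"
  proof (rule Bochner_Integration.integrable_bound)
    show "integrable lborel (\<lambda>k::real^3. C * (\<Prod>b\<in>Basis. inverse (1 + (k \<bullet> b)\<^sup>2)))"
      by (intro integrable_mult_right integrable_prod_inverse_1_plus_square)
    show "(\<lambda>k. (norm (?F k))\<^sup>2) \<in> borel_measurable lborel"
      using meas by measurable
    show "AE k in lborel. norm ((norm (?F k))\<^sup>2) \<le> norm (C * (\<Prod>b\<in>Basis. inverse (1 + (k \<bullet> b)\<^sup>2)))"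
      using le by (intro AE_I2) (simp only: real_norm_def abs_of_nonneg zero_le_power2 abs_ge_self order_trans[OF _ abs_ge_self])
  qed
  then show ?thesis
    using meas by (simp add: photon_space_def dot_cross_self)
qed

lemma
  assumes "schwartz chi"
  shows a_field_photon_space: "a_field chi x m \<in> photon_space"
    and b_field_photon_space: "b_field chi x m \<in> photon_space"
  unfolding a_field_def b_field_def
  by (intro radial_cutoff_photon_space assms; simp)+

lemma coupling_one_particle: "schwartz chi \<Longrightarrow> coupling chi x m \<in> one_particle"
  unfolding coupling_def by (intro cplx_one_particle a_field_photon_space b_field_photon_space)

lemma coupling_eq_0: "chi (norm (fst w)) = 0 \<Longrightarrow> coupling chi x m w = 0"
  by (cases w) (simp add: coupling_def cplx_def a_field_def b_field_def zero_complex.code)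

section \<open>Spins\<close>

lemma cnj_pauli: "cnj (pauli m $ i $ j) = pauli m $ j $ i"
  using exhaust_2[of i] exhaust_2[of j] by (auto simp: pauli_def)

lemma cnj_pauli_at: "cnj (pauli_at m l $ s $ t) = pauli_at m l $ t $ s"
  by (auto simp: pauli_at_def cnj_pauli)

lemma spin_inner_mult_vec:
  "spin_inner (S *v a) b = (\<Sum>s\<in>UNIV. \<Sum>t\<in>UNIV. S $ s $ t * a $ t * cnj (b $ s))"
  by (simp add: spin_inner_def matrix_vector_mult_def sum_distrib_right)

lemma spin_inner_hermitian_real:
  assumes "\<And>s t. cnj (S $ s $ t) = S $ t $ s"
  shows "complex_of_real (Re (spin_inner (S *v a) a)) = spin_inner (S *v a) a"
proof -
  have "cnj (spin_inner (S *v a) a) = (\<Sum>s\<in>UNIV. \<Sum>t\<in>UNIV. S $ t $ s * a $ s * cnj (a $ t))"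
    by (simp add: spin_inner_mult_vec assms ac_simps)
  also have "\<dots> = spin_inner (S *v a) a"
    unfolding spin_inner_mult_vec by (rule sum.swap)
  finally have "spin_inner (S *v a) a \<in> \<real>"
    by (simp add: Reals_cnj_iff)
  then show ?thesis
    by (simp add: of_real_Re)
qed

lemma pi_fun_i_pauli_at: "pi_fun a (i_pauli_at m l) = Re (spin_inner (pauli_at m l *v a) a)"
proof -
  have "spin_inner (i_pauli_at m l *v a) a = \<i> * spin_inner (pauli_at m l *v a) a"
    by (simp add: spin_inner_mult_vec i_pauli_at_def map_matrix_def sum_distrib_left mult.assoc)
  then show ?thesis
    by (simp add: pi_fun_def)
qed

text \<open>The expectation of a Hermitian matrix is real, so \<open>Re\<close> loses nothing. Hence
  the coefficients in the classical equations are exactly the weights of the averaged quantum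
  field.\<close>

lemma of_real_pi_fun_i_pauli_at:
  "complex_of_real (pi_fun a (i_pauli_at m l)) = spin_inner (pauli_at m l *v a) a"
  unfolding pi_fun_i_pauli_at by (rule spin_inner_hermitian_real) (rule cnj_pauli_at)

text \<open>All entries of a unit vector have modulus at most 1. The bound is far from sharp, but it
  depends neither on the state nor on \<open>h\<close>, and this is the source of
  uniformity.\<close>

lemma abs_pi_fun_i_pauli_at_le:
  fixes a :: "'n::finite spin_vec"
  assumes "norm a = 1"
  shows "\<bar>pi_fun a (i_pauli_at m l)\<bar> \<le> (\<Sum>s\<in>UNIV. \<Sum>t\<in>UNIV. cmod (pauli_at m l $ s $ t))"
proof -
  have le1: "cmod (a $ s) \<le> 1" for s
    using assms Finite_Cartesian_Product.norm_nth_le[of a s] by simp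
  have "\<bar>pi_fun a (i_pauli_at m l)\<bar> \<le> cmod (spin_inner (pauli_at m l *v a) a)"
    unfolding pi_fun_i_pauli_at by (rule abs_Re_le_cmod)
  also have "\<dots> \<le> (\<Sum>s\<in>UNIV. \<Sum>t\<in>UNIV. cmod (pauli_at m l $ s $ t * a $ t * cnj (a $ s)))"
    unfolding spin_inner_mult_vec by (intro order_trans[OF norm_sum] sum_mono norm_sum)
  also have "\<dots> \<le> (\<Sum>s\<in>UNIV. \<Sum>t\<in>UNIV. cmod (pauli_at m l $ s $ t) * (1 * 1))"
    unfolding norm_mult complex_mod_cnj mult.assoc
    by (intro sum_mono mult_left_mono mult_mono le1) auto
  finally show ?thesis by simp
qed

text \<open>Row \<open>s\<close> of the matrix meets only configurations that agree with
  \<open>s\<close> off \<open>l\<close>. They are determined by their value at \<open>l\<close>,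
  which turns the sum over configurations into the two-term sum of the 2 by 2 matrix.\<close>

lemma pauli_at_spin_tensor:
  "pauli_at m l *v spin_tensor u = spin_tensor (u(l := pauli m *v u l))"
proof (simp only: vec_eq_iff, rule allI)
  fix s :: "'a \<Rightarrow> 2"
  have upd: "s(l := t l) = t" if "\<forall>l'. l' \<noteq> l \<longrightarrow> s l' = t l'" for t
    using that by (auto simp: fun_eq_iff)
  have "(pauli_at m l *v spin_tensor u) $ s
      = (\<Sum>t\<in>{t. \<forall>l'. l' \<noteq> l \<longrightarrow> s l' = t l'}. pauli m $ s l $ t l * spin_tensor u $ t)"
    by (simp add: matrix_vector_mult_def pauli_at_def if_distrib[of "\<lambda>z. z * _"]
        sum.If_cases cong: if_cong)
  also have "\<dots> = (\<Sum>c\<in>UNIV. pauli m $ s l $ c * spin_tensor u $ (s(l := c)))"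
    by (rule sum.reindex_bij_witness[where i = "\<lambda>c. s(l := c)" and j = "\<lambda>t. t l"]) (auto simp: upd)
  also have "\<dots> = (\<Sum>c\<in>UNIV. pauli m $ s l $ c * u l $ c) * (\<Prod>l'\<in>UNIV - {l}. u l' $ s l')"
    by (simp add: spin_tensor_def prod.remove[of UNIV l] sum_distrib_right mult.assoc)
  also have "\<dots> = spin_tensor (u(l := pauli m *v u l)) $ s"
    by (simp add: spin_tensor_def prod.remove[of UNIV l] matrix_vector_mult_def)
  finally show "(pauli_at m l *v spin_tensor u) $ s = spin_tensor (u(l := pauli m *v u l)) $ s" .
qed

lemma sum_pauli_at_spin_tensor_eigen:
  assumes "(\<Sum>m\<in>UNIV. \<beta> $ m *\<^sub>R (pauli m *v u l)) = e *\<^sub>R u l"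
  shows "(\<Sum>m\<in>UNIV. complex_of_real (\<beta> $ m) * (pauli_at m l *v spin_tensor u) $ s)
    = complex_of_real e * spin_tensor u $ s"
proof -
  have "(\<Sum>m\<in>UNIV. complex_of_real (\<beta> $ m) * (pauli_at m l *v spin_tensor u) $ s)
      = (\<Sum>m\<in>UNIV. \<beta> $ m *\<^sub>R (pauli m *v u l)) $ s l * (\<Prod>l'\<in>UNIV - {l}. u l' $ s l')"
    unfolding pauli_at_spin_tensor by (simp add: spin_tensor_def prod.remove[of UNIV l] sum_distrib_right
        scaleR_conv_of_real[where 'a = complex] mult.assoc)
  also have "\<dots> = complex_of_real e * spin_tensor u $ s"
    unfolding assms by (simp add: spin_tensor_def prod.remove[of UNIV l] scaleR_conv_of_real[where 'a = complex])
  finally show ?thesis .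
qed

lemma spin_conf_vec_eigen:
  fixes E :: "'n::finite set"
  assumes b0: "(\<Sum>m\<in>UNIV. \<beta> $ m *\<^sub>R (pauli m *v b0)) = - norm \<beta> *\<^sub>R b0"
    and b1: "(\<Sum>m\<in>UNIV. \<beta> $ m *\<^sub>R (pauli m *v b1)) = norm \<beta> *\<^sub>R b1"
  shows "(\<Sum>l\<in>UNIV. \<Sum>m\<in>UNIV. complex_of_real (\<beta> $ m) * (pauli_at m l *v spin_conf_vec b0 b1 E) $ s)
    = complex_of_real ((2 * real (card E) - real CARD('n)) * norm \<beta>) * spin_conf_vec b0 b1 E $ s"
proof -
  let ?e = "\<lambda>l. if l \<in> E then norm \<beta> else - norm \<beta>"
  have "(\<Sum>m\<in>UNIV. complex_of_real (\<beta> $ m) * (pauli_at m l *v spin_conf_vec b0 b1 E) $ s)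
      = complex_of_real (?e l) * spin_conf_vec b0 b1 E $ s" for l
    unfolding spin_conf_vec_def by (rule sum_pauli_at_spin_tensor_eigen) (simp add: b0 b1)
  \<comment> \<open>Each site in \<open>E\<close> contributes \<open>norm \<beta>\<close> and each
    other site its negative, which makes \<open>|E| - (N - |E|)\<close> multiples in all.\<close>
  moreover have "(\<Sum>l\<in>UNIV. ?e l) = (2 * real (card E) - real CARD('n)) * norm \<beta>"
  proof -
    have "real (card (- E)) = real CARD('n) - real (card E)"
      by (simp add: Compl_eq_Diff_UNIV card_Diff_subset of_nat_diff card_mono)
    moreover have "(\<Sum>l\<in>UNIV. ?e l) = real (card E) * norm \<beta> - real (card (- E)) * norm \<beta>"
      by (simp add: sum.If_cases)
    ultimately show ?thesis
      by (simp add: left_diff_distrib)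
  qed
  ultimately show ?thesis
    by (simp add: sum_distrib_right[symmetric] flip: of_real_sum)
qed

section \<open>Coherent states at stationary points\<close>

definition mode_mult :: "(mode \<Rightarrow> complex) \<Rightarrow> mode \<Rightarrow> complex" where
  "mode_mult z = (\<lambda>w. complex_of_real (norm (fst w)) * z w)"

definition amplitude :: "real \<Rightarrow> (real^3 \<Rightarrow> real^3) \<Rightarrow> (real^3 \<Rightarrow> real^3) \<Rightarrow> mode \<Rightarrow> complex" where
  "amplitude h q p = (\<lambda>w. complex_of_real (1 / sqrt (2 * h)) * cplx q p w)"

definition coherent_weight :: "real \<Rightarrow> (real^3 \<Rightarrow> real^3) \<Rightarrow> (real^3 \<Rightarrow> real^3) \<Rightarrow> real" where
  "coherent_weight h q p = exp (- (photon_inner q q + photon_inner p p) / (4 * h))"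

text \<open>Site and field index are paired so that the lemmas on finite sums of one-particle
  functions apply with a single index.\<close>

definition spin_coupling :: "(real \<Rightarrow> real) \<Rightarrow> ('n::finite \<Rightarrow> real^3) \<Rightarrow> 'n \<times> 3 \<Rightarrow> mode \<Rightarrow> complex" where
  "spin_coupling chi x = (\<lambda>(l, m). coupling chi (x l) m)"

lemma sum_sum_UNIV: "(\<Sum>l\<in>UNIV. \<Sum>m\<in>UNIV. f l m) = (\<Sum>r\<in>UNIV. f (fst r) (snd r))"
  by (simp add: sum.cartesian_product case_prod_unfold)

lemma spin_coupling_one_particle: "schwartz chi \<Longrightarrow> spin_coupling chi x r \<in> one_particle"
  by (simp add: spin_coupling_def coupling_one_particle split: prod.split)

lemma mode_mult_cplx: "mode_mult (cplx q p) = cplx (mult_norm q) (mult_norm p)"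
  by (auto simp: mode_mult_def cplx_def mult_norm_def complex_eq_iff fun_eq_iff)

lemma mode_mult_amplitude:
  "mode_mult (amplitude h q p) = (\<lambda>w. complex_of_real (1 / sqrt (2 * h)) * mode_mult (cplx q p) w)"
  by (simp add: mode_mult_def amplitude_def fun_eq_iff)

lemma coherent_eq: "h > 0 \<Longrightarrow> coherent h q p =
    fock_scale (complex_of_real (coherent_weight h q p)) (exp_vec (amplitude h q p))"
  by (simp add: coherent_eq_exp_vec coherent_weight_def amplitude_def)

lemma amplitude_one_particle:
  "q \<in> photon_space \<Longrightarrow> p \<in> photon_space \<Longrightarrow> amplitude h q p \<in> one_particle"
  unfolding amplitude_def by (intro one_particle_scale cplx_one_particle)

lemma mode_mult_cplx_one_particle:
  "q \<in> dom_mult_norm \<Longrightarrow> p \<in> dom_mult_norm \<Longrightarrow> mode_mult (cplx q p) \<in> one_particle"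
  unfolding mode_mult_cplx by (intro cplx_one_particle) (auto simp: dom_mult_norm_def)

lemma mode_mult_amplitude_one_particle:
  "q \<in> dom_mult_norm \<Longrightarrow> p \<in> dom_mult_norm \<Longrightarrow> mode_mult (amplitude h q p) \<in> one_particle"
  unfolding mode_mult_amplitude by (intro one_particle_scale mode_mult_cplx_one_particle)

text \<open>The weight makes the exponential vector a unit vector: \<open>|z|^2\<close> is
  \<open>(|q|^2 + |p|^2) / (2 h)\<close>, which is minus twice the exponent in the weight.\<close>

lemma coherent_weight_square:
  assumes "h > 0" "q \<in> photon_space" "p \<in> photon_space"
  shows "(coherent_weight h q p)\<^sup>2 = exp (- normsq (amplitude h q p))"
proof -
  have "normsq (amplitude h q p) = (photon_inner q q + photon_inner p p) / (2 * h)"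
    using assms unfolding amplitude_def
    by (subst normsq_scale) (auto intro: cplx_one_particle
        simp: normsq_cplx norm_divide power_divide power_mult_distrib abs_mult)
  moreover have "- I / (4 * h) + - I / (4 * h) = - (I / (2 * h))" for I
    using assms(1) by (simp add: field_simps)
  ultimately show ?thesis
    by (simp only: coherent_weight_def power2_eq_square exp_add[symmetric])
qed

lemma H_ph_exp_vec: "H_ph h (exp_vec z) = fock_scale (complex_of_real h) (creation (mode_mult z) (exp_vec z))"
  by (simp add: H_ph_def dGamma_norm_exp_vec mode_mult_def)

text \<open>On an exponential vector each operator yields a multiple of the same vector, a created
  one, or a sum of both. Membership in Fock space thus reduces to square integrability of the
  created function: Mz for \<open>H_ph\<close>, which is where the domain of M enters, and the
  coupling function for a field.\<close>

lemma coherent_sum_dom: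
  assumes chi: "schwartz chi" and h: "h > 0" and q: "q \<in> dom_mult_norm" and p: "p \<in> dom_mult_norm"
  shows "coherent h q p \<in> sum_dom chi x h"
proof -
  let ?z = "amplitude h q p"
  have qp: "q \<in> photon_space" "p \<in> photon_space"
    using q p by (auto simp: dom_mult_norm_def)
  note z = amplitude_one_particle[OF qp, of h]
  have e: "exp_vec ?z \<in> fock_space"
    by (rule exp_vec_fock_space[OF z])
  have "H_ph h (exp_vec ?z) \<in> fock_space"
    unfolding H_ph_exp_vec
    by (intro fock_space_scale creation_exp_vec_fock_space mode_mult_amplitude_one_particle q p z)
  moreover have "B_op chi h (x l) m (exp_vec ?z) \<in> fock_space" for l m
  proof -
    have "B_op chi h (x l) m (exp_vec ?z) = fock_scale (complex_of_real (sqrt h / sqrt 2))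
        (\<lambda>n K. fock_scale (mode_inner (coupling chi (x l) m) ?z) (exp_vec ?z) n K
          + creation (coupling chi (x l) m) (exp_vec ?z) n K)"
      by (simp add: fun_eq_iff B_op_exp_vec fock_scale_def)
    also have "\<dots> \<in> fock_space"
      by (intro fock_space_scale fock_space_add creation_exp_vec_fock_space e z coupling_one_particle chi)
    finally show ?thesis .
  qed
  ultimately show ?thesis
    using e by (simp add: sum_dom_def op_dom_def coherent_eq[OF h] H_ph_fock_scale B_op_fock_scale fock_space_scale)
qed

text \<open>The vanishing of p' is the real part, and that of q' the imaginary part, of one complex
  equation for q + ip.\<close>

lemma stationary_modes:
  assumes "stationary chi x \<beta> h q p \<omega>"
  shows "AE w in mode_measure. mode_mult (cplx q p) w = complex_of_real (- h) *
    (\<Sum>r\<in>UNIV. complex_of_real (\<omega> (i_pauli_at (snd r) (fst r))) * spin_coupling chi x r w)"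
proof -
  let ?c = "\<lambda>l m. \<omega> (i_pauli_at m l)"
  have "AE k in lborel. mult_norm p k = - h *\<^sub>R (\<Sum>l\<in>UNIV. \<Sum>m\<in>UNIV. ?c l m *\<^sub>R b_field chi (x l) m k)
      \<and> mult_norm q k = - h *\<^sub>R (\<Sum>l\<in>UNIV. \<Sum>m\<in>UNIV. ?c l m *\<^sub>R a_field chi (x l) m k)"
  proof -
    have "AE k in lborel. mult_norm p k + h *\<^sub>R (\<Sum>l\<in>UNIV. \<Sum>m\<in>UNIV. ?c l m *\<^sub>R b_field chi (x l) m k) = 0"
      "AE k in lborel. mult_norm q k + h *\<^sub>R (\<Sum>l\<in>UNIV. \<Sum>m\<in>UNIV. ?c l m *\<^sub>R a_field chi (x l) m k) = 0"
      using assms by (auto simp: stationary_def minus_diff_commute neg_eq_iff_add_eq_0[symmetric] elim: eventually_mono)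
    then show ?thesis
      by eventually_elim (simp add: eq_neg_iff_add_eq_0 add.commute)
  qed
  from AE_mode_fst[OF this] show ?thesis
  proof eventually_elim
    case (elim w)
    obtain k j where w: "w = (k, j)" by (cases w)
    have P: "mult_norm p k $ j = - h * (\<Sum>l\<in>UNIV. \<Sum>m\<in>UNIV. ?c l m * b_field chi (x l) m k $ j)"
      and Q: "mult_norm q k $ j = - h * (\<Sum>l\<in>UNIV. \<Sum>m\<in>UNIV. ?c l m * a_field chi (x l) m k $ j)"
      using elim by (simp_all add: w)
    note P = P[unfolded sum_sum_UNIV] and Q = Q[unfolded sum_sum_UNIV]
    show ?case
      unfolding mode_mult_cplx
      by (simp add: complex_eq_iff w cplx_def P Q spin_coupling_def coupling_def case_prod_unfold)
  qed
qed

text \<open>The complex equation is paired with q + ip. The weights are real, so conjugation does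
  not affect them; on the other side the symplectic part vanishes because multiplication by
  \<open>norm k\<close> is symmetric, which makes the whole sum real.\<close>

lemma stationary_energy:
  assumes chi: "schwartz chi" and st: "stationary chi x \<beta> h q p \<omega>"
  shows "complex_of_real h * (\<Sum>r\<in>UNIV. complex_of_real (\<omega> (i_pauli_at (snd r) (fst r))) *
      mode_inner (spin_coupling chi x r) (cplx q p))
    = - complex_of_real (\<integral>k. norm k * ((norm (q k))\<^sup>2 + (norm (p k))\<^sup>2) \<partial>lborel)"
proof -
  have dom: "q \<in> dom_mult_norm" "p \<in> dom_mult_norm"
    using st by (auto simp: stationary_def)
  then have qp: "q \<in> photon_space" "p \<in> photon_space" "mult_norm q \<in> photon_space" "mult_norm p \<in> photon_space"
    by (auto simp: dom_mult_norm_def)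
  let ?g = "cplx q p"
  let ?c = "\<lambda>r. \<omega> (i_pauli_at (snd r) (fst r))"
  let ?f = "spin_coupling chi x"
  have g: "?g \<in> one_particle"
    using qp by (intro cplx_one_particle)
  note f = spin_coupling_one_particle[OF chi, of x]
  have "mode_inner (mode_mult ?g) ?g = (\<integral>w. (\<Sum>r\<in>UNIV. complex_of_real (- h * ?c r) * (cnj (?f r w) * ?g w)) \<partial>mode_measure)"
    unfolding mode_inner_def
  proof (rule integral_cong_AE)
    show "(\<lambda>w. cnj (mode_mult ?g w) * ?g w) \<in> borel_measurable mode_measure"
      by (rule borel_measurable_integrable) (intro integrable_mode_inner mode_mult_cplx_one_particle dom g)
    show "(\<lambda>w. \<Sum>r\<in>UNIV. complex_of_real (- h * ?c r) * (cnj (?f r w) * ?g w)) \<in> borel_measurable mode_measure"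
      by (rule borel_measurable_integrable)
        (intro Bochner_Integration.integrable_sum integrable_mult_right integrable_mode_inner f g)
    show "AE w in mode_measure. cnj (mode_mult ?g w) * ?g w
        = (\<Sum>r\<in>UNIV. complex_of_real (- h * ?c r) * (cnj (?f r w) * ?g w))"
      using stationary_modes[OF st]
      by eventually_elim (simp add: sum_distrib_left sum_distrib_right mult.assoc sum_negf)
  qed
  also have "\<dots> = (\<Sum>r\<in>UNIV. complex_of_real (- h * ?c r) * mode_inner (?f r) ?g)"
    unfolding mode_inner_def using integrable_mode_inner[OF f g]
    by (subst Bochner_Integration.integral_sum) (auto intro!: integrable_mult_right)
  also have "\<dots> = - (complex_of_real h * (\<Sum>r\<in>UNIV. complex_of_real (?c r) * mode_inner (?f r) ?g))"
    by (simp add: sum_distrib_left mult.assoc sum_negf)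
  finally have 1: "mode_inner (mode_mult ?g) ?g
      = - (complex_of_real h * (\<Sum>r\<in>UNIV. complex_of_real (?c r) * mode_inner (?f r) ?g))" .
  have "mode_inner (mode_mult ?g) ?g = Complex (photon_inner (mult_norm q) q + photon_inner (mult_norm p) p)
      (photon_inner (mult_norm q) p - photon_inner (mult_norm p) q)"
    unfolding mode_mult_cplx by (rule mode_inner_cplx) (use qp in auto)
  moreover have "photon_inner (mult_norm q) p = photon_inner (mult_norm p) q"
    by (simp add: photon_inner_def mult_norm_def inner_commute)
  moreover have "photon_inner (mult_norm q) q + photon_inner (mult_norm p) p
      = (\<integral>k. norm k * ((norm (q k))\<^sup>2 + (norm (p k))\<^sup>2) \<partial>lborel)"
    unfolding photon_inner_def
    using integrable_inner_photon[OF qp(3) qp(1)] integrable_inner_photon[OF qp(4) qp(2)]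
    by (subst Bochner_Integration.integral_add[symmetric])
      (auto simp: mult_norm_def power2_norm_eq_inner distrib_left)
  ultimately have "mode_inner (mode_mult ?g) ?g
      = complex_of_real (\<integral>k. norm k * ((norm (q k))\<^sup>2 + (norm (p k))\<^sup>2) \<partial>lborel)"
    by (simp add: complex_eq_iff)
  with 1 have "complex_of_real (\<integral>k. norm k * ((norm (q k))\<^sup>2 + (norm (p k))\<^sup>2) \<partial>lborel)
      = - (complex_of_real h * (\<Sum>r\<in>UNIV. complex_of_real (?c r) * mode_inner (?f r) ?g))"
    by (simp only:)
  then show ?thesis
    by (simp only: minus_minus)
qed

text \<open>By the preceding virial identity the interaction energy is minus twice the photon
  energy, so together they give minus the photon energy.\<close>

lemma hamiltonian_fun_stationary:
  assumes chi: "schwartz chi" and st: "stationary chi x \<beta> h q p \<omega>"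
  shows "hamiltonian_fun chi x \<beta> h q p \<omega> = h * (\<Sum>r\<in>UNIV. \<beta> $ snd r * \<omega> (i_pauli_at (snd r) (fst r)))
    - 1/2 * (\<integral>k. norm k * ((norm (q k))\<^sup>2 + (norm (p k))\<^sup>2) \<partial>lborel)"
proof -
  have qp: "q \<in> photon_space" "p \<in> photon_space"
    using st by (auto simp: stationary_def dom_mult_norm_def)
  have "Re (mode_inner (spin_coupling chi x r) (cplx q p)) = B_cl chi (x (fst r)) (snd r) q p" for r
    using mode_inner_cplx[OF a_field_photon_space[OF chi] b_field_photon_space[OF chi] qp]
    by (simp add: spin_coupling_def coupling_def B_cl_def case_prod_unfold)
  then have "h * (\<Sum>r\<in>UNIV. \<omega> (i_pauli_at (snd r) (fst r)) * B_cl chi (x (fst r)) (snd r) q p)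
      = - (\<integral>k. norm k * ((norm (q k))\<^sup>2 + (norm (p k))\<^sup>2) \<partial>lborel)"
    using arg_cong[OF stationary_energy[OF chi st], of Re] by simp
  moreover have "hamiltonian_fun chi x \<beta> h q p \<omega> = 1/2 * (\<integral>k. norm k * ((norm (q k))\<^sup>2 + (norm (p k))\<^sup>2) \<partial>lborel)
      + (h * (\<Sum>r\<in>UNIV. \<beta> $ snd r * \<omega> (i_pauli_at (snd r) (fst r)))
      + h * (\<Sum>r\<in>UNIV. \<omega> (i_pauli_at (snd r) (fst r)) * B_cl chi (x (fst r)) (snd r) q p))"
    by (simp add: hamiltonian_fun_def sum_sum_UNIV case_prod_unfold distrib_right sum.distrib distrib_left mult.commute)
  ultimately show ?thesis
    by simp
qed

lemma averaged_op_coherent: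
  fixes x :: "'n::finite \<Rightarrow> real^3"
  assumes chi: "schwartz chi" and st: "stationary chi x \<beta> h q p (pi_fun a)" and h: "h > 0"
  shows "fock_eq (averaged_op chi x \<beta> h a (coherent h q p))
    (fock_scale (complex_of_real (hamiltonian_fun chi x \<beta> h q p (pi_fun a))) (coherent h q p))"
  unfolding fock_eq_def
proof
  fix n
  let ?c = "\<lambda>r. complex_of_real (pi_fun a (i_pauli_at (snd r) (fst r)))"
  let ?f = "spin_coupling chi x"
  let ?z = "amplitude h q p"
  let ?e = "exp_vec ?z"
  let ?\<kappa> = "complex_of_real (coherent_weight h q p)"
  let ?s = "complex_of_real (sqrt h / sqrt 2)"
  let ?W = "\<integral>k. norm k * ((norm (q k))\<^sup>2 + (norm (p k))\<^sup>2) \<partial>lborel"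
  \<comment> \<open>These combine the factor \<open>sqrt h / sqrt 2\<close> of the Segal field with
    \<open>1 / sqrt (2 * h)\<close> of the amplitude. The first identity produces the 1/2 in the
    energy; the second makes \<open>H_ph\<close> match the creation part of the averaged
    field.\<close>
  have s: "sqrt h / sqrt 2 * (1 / sqrt (2 * h)) = 1 / 2" "h * (1 / sqrt (2 * h)) = sqrt h / sqrt 2"
    using h by (simp_all add: real_sqrt_mult field_simps)
  have "AE w in mode_measure. mode_mult ?z w = - ?s * (\<Sum>r\<in>UNIV. ?c r * ?f r w)"
    using stationary_modes[OF st]
  proof eventually_elim
    case (elim w)
    have "mode_mult ?z w = - complex_of_real (h * (1 / sqrt (2 * h))) * (\<Sum>r\<in>UNIV. ?c r * ?f r w)"
      unfolding mode_mult_amplitude elim by simp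
    then show ?case by (simp only: s)
  qed
  then have "AE K in modes_measure n. creation (mode_mult ?z) ?e n K
      = creation (\<lambda>w. - ?s * (\<Sum>r\<in>UNIV. ?c r * ?f r w)) ?e n K"
    by (rule creation_exp_vec_cong_AE)
  then show "AE K in modes_measure n. averaged_op chi x \<beta> h a (coherent h q p) n K =
      fock_scale (complex_of_real (hamiltonian_fun chi x \<beta> h q p (pi_fun a))) (coherent h q p) n K"
  proof eventually_elim
    case (elim K)
    have H: "H_ph h (coherent h q p) n K
        = ?\<kappa> * (- (complex_of_real h * ?s) * (\<Sum>r\<in>UNIV. ?c r * creation (?f r) ?e n K))"
      unfolding coherent_eq[OF h] H_ph_fock_scale H_ph_exp_vec
      by (simp only: fock_scale_def elim creation_scale_left creation_sum) (simp add: mult.assoc)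
    have B: "B_op chi h (x l) m (coherent h q p) n K
        = ?\<kappa> * (?s * (mode_inner (?f (l, m)) ?z * ?e n K + creation (?f (l, m)) ?e n K))" for l m
      unfolding coherent_eq[OF h] B_op_fock_scale by (simp add: fock_scale_def B_op_exp_vec spin_coupling_def)
    have E: "?s * (\<Sum>r\<in>UNIV. ?c r * mode_inner (?f r) ?z) * complex_of_real h = - complex_of_real (1 / 2 * ?W)"
    proof -
      have "?s * (\<Sum>r\<in>UNIV. ?c r * mode_inner (?f r) ?z)
          = complex_of_real (sqrt h / sqrt 2 * (1 / sqrt (2 * h))) * (\<Sum>r\<in>UNIV. ?c r * mode_inner (?f r) (cplx q p))"
        unfolding amplitude_def mode_inner_scale_right of_real_mult
        by (simp only: sum_distrib_left mult.left_commute mult.assoc)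
      also have "\<dots> = complex_of_real (1 / 2) * (\<Sum>r\<in>UNIV. ?c r * mode_inner (?f r) (cplx q p))"
        by (simp only: s)
      finally have "?s * (\<Sum>r\<in>UNIV. ?c r * mode_inner (?f r) ?z) * complex_of_real h
          = complex_of_real (1 / 2) * (complex_of_real h * (\<Sum>r\<in>UNIV. ?c r * mode_inner (?f r) (cplx q p)))"
        by (simp only: mult_ac)
      then show ?thesis
        unfolding stationary_energy[OF chi st] by simp
    qed
    \<comment> \<open>Separates the magnetic term, the annihilation part and the creation part of
      the averaged sum.\<close>
    have collect: "(\<Sum>r\<in>UNIV. (b r * (y * e) + y * (t * (m r * e + d r))) * c r)
        = y * e * (\<Sum>r\<in>UNIV. b r * c r) + y * e * (t * (\<Sum>r\<in>UNIV. c r * m r)) + y * (t * (\<Sum>r\<in>UNIV. c r * d r))"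
      for b c d m :: "'n \<times> 3 \<Rightarrow> complex" and y e t
      by (simp add: sum_distrib_left sum.distrib algebra_simps)
    have "averaged_op chi x \<beta> h a (coherent h q p) n K = H_ph h (coherent h q p) n K + complex_of_real h *
        (\<Sum>r\<in>UNIV. (complex_of_real (\<beta> $ snd r) * (?\<kappa> * ?e n K)
          + ?\<kappa> * (?s * (mode_inner (?f r) ?z * ?e n K + creation (?f r) ?e n K))) * ?c r)"
      by (simp add: averaged_op_def B sum_sum_UNIV case_prod_unfold of_real_pi_fun_i_pauli_at)
        (simp add: coherent_eq[OF h] fock_scale_def)
    also have "\<dots> = H_ph h (coherent h q p) n K
        + ?\<kappa> * ?e n K * (complex_of_real h * (\<Sum>r\<in>UNIV. complex_of_real (\<beta> $ snd r) * ?c r))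
        + ?\<kappa> * ?e n K * (?s * (\<Sum>r\<in>UNIV. ?c r * mode_inner (?f r) ?z) * complex_of_real h)
        + ?\<kappa> * (complex_of_real h * ?s * (\<Sum>r\<in>UNIV. ?c r * creation (?f r) ?e n K))"
      unfolding collect by (simp only: distrib_left mult_ac add_ac)
    \<comment> \<open>The creation parts cancel, and the annihilation part contributes minus the
      photon energy.\<close>
    also have "\<dots> = ?\<kappa> * ?e n K * (complex_of_real h * (\<Sum>r\<in>UNIV. complex_of_real (\<beta> $ snd r) * ?c r)
        - complex_of_real (1 / 2 * ?W))"
      unfolding H E by (simp add: algebra_simps)
    also have "\<dots> = ?\<kappa> * ?e n K * complex_of_real (hamiltonian_fun chi x \<beta> h q p (pi_fun a))"
      by (simp add: hamiltonian_fun_stationary[OF chi st])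
    finally show ?case
      by (simp add: coherent_eq[OF h] fock_scale_def)
  qed
qed

section \<open>Size of the amplitude and of the residual\<close>

lemma normsq_cong_AE:
  assumes "f \<in> one_particle" "g \<in> one_particle" "AE w in mode_measure. f w = g w"
  shows "normsq f = normsq g"
proof -
  note [measurable] = one_particleD(1)[OF assms(1)] one_particleD(1)[OF assms(2)]
  show ?thesis
    unfolding normsq_def using assms(3) by (intro integral_cong_AE) auto
qed

text \<open>
  The amplitude vanishes where the couplings do, in particular for \<open>|k| < \<rho>\<close>; this turns the
  bound for \<open>|k| z\<close> into one for \<open>z\<close>.
\<close>

lemma stationary_amplitude_bounds:
  fixes x :: "'n::finite \<Rightarrow> real^3"
  assumes chi: "schwartz chi" and cutoff: "\<And>r. \<bar>r\<bar> < \<rho> \<Longrightarrow> chi r = 0" and \<rho>: "\<rho> > 0"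
    and st: "stationary chi x \<beta> h q p \<omega>" and h: "h > 0"
    and D: "(\<Sum>r\<in>UNIV. (\<omega> (i_pauli_at (snd r) (fst r)))\<^sup>2) * (\<Sum>r\<in>UNIV. normsq (spin_coupling chi x r)) \<le> D"
  shows "normsq (mode_mult (amplitude h q p)) \<le> h * D"
    and "\<rho>\<^sup>2 * normsq (amplitude h q p) \<le> h * D"
proof -
  have dom: "q \<in> dom_mult_norm" "p \<in> dom_mult_norm"
    using st by (auto simp: stationary_def)
  then have qp: "q \<in> photon_space" "p \<in> photon_space"
    by (auto simp: dom_mult_norm_def)
  let ?c = "\<lambda>r. complex_of_real (\<omega> (i_pauli_at (snd r) (fst r)))"
  let ?F = "\<lambda>w. \<Sum>r\<in>UNIV. ?c r * spin_coupling chi x r w"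
  let ?z = "amplitude h q p"
  let ?s = "complex_of_real (- sqrt h / sqrt 2)"
  note Mz = mode_mult_amplitude_one_particle[OF dom, of h]
  note z = amplitude_one_particle[OF qp, of h]
  have F: "?F \<in> one_particle"
    by (intro one_particle_sum spin_coupling_one_particle chi)
  have s: "1 / sqrt (2 * h) * (- h) = - sqrt h / sqrt 2"
    using h by (simp add: real_sqrt_mult field_simps)
  have AE: "AE w in mode_measure. mode_mult ?z w = ?s * ?F w"
    using stationary_modes[OF st]
  proof eventually_elim
    case (elim w)
    then show ?case
      by (simp only: mode_mult_amplitude mult.assoc[symmetric] of_real_mult[symmetric] s)
  qed
  have "normsq (mode_mult ?z) = normsq (\<lambda>w. ?s * ?F w)"
    by (rule normsq_cong_AE[OF Mz one_particle_scale[OF F] AE])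
  also have "\<dots> = h / 2 * normsq ?F"
    unfolding normsq_scale[OF F] using h by (simp add: norm_divide power_divide)
  also have "\<dots> \<le> h / 2 * D"
  proof (rule mult_left_mono)
    have "normsq ?F \<le> (\<Sum>r\<in>UNIV. (cmod (?c r))\<^sup>2) * (\<Sum>r\<in>UNIV. normsq (spin_coupling chi x r))"
      by (intro normsq_sum_le spin_coupling_one_particle chi)
    then show "normsq ?F \<le> D"
      using D by simp
  qed (use h in simp)
  also have "\<dots> \<le> h * D"
  proof -
    have "0 \<le> D"
      using D by (rule order_trans[rotated]) (intro mult_nonneg_nonneg sum_nonneg, auto)
    then show ?thesis
      using h by simp
  qed
  finally show le: "normsq (mode_mult ?z) \<le> h * D" .
  \<comment> \<open>At zero momentum the equation for \<open>mode_mult ?z\<close> says nothing about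
    \<open>?z\<close>; this single point is a null set.\<close>
  have "AE w in mode_measure. fst w \<noteq> 0"
    by (rule AE_mode_fst) (rule AE_lborel_singleton)
  then have "AE w in mode_measure. \<rho>\<^sup>2 * (cmod (?z w))\<^sup>2 \<le> (cmod (mode_mult ?z w))\<^sup>2"
    using AE
  proof eventually_elim
    case (elim w)
    show ?case
    proof (cases "norm (fst w) < \<rho>")
      case True
      then have "?F w = 0"
        using cutoff[of "norm (fst w)"] by (simp add: spin_coupling_def case_prod_unfold coupling_eq_0)
      then have "mode_mult ?z w = 0"
        using elim(2) by simp
      then show ?thesis
        using elim(1) by (simp add: mode_mult_def)
    next
      case False
      then have "\<rho>\<^sup>2 * (cmod (?z w))\<^sup>2 \<le> (norm (fst w))\<^sup>2 * (cmod (?z w))\<^sup>2"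
        using \<rho> by (intro mult_right_mono power_mono) auto
      then show ?thesis
        by (simp add: mode_mult_def norm_mult power_mult_distrib)
    qed
  qed
  then have "(\<integral>w. \<rho>\<^sup>2 * (cmod (?z w))\<^sup>2 \<partial>mode_measure) \<le> normsq (mode_mult ?z)"
    unfolding normsq_def
    by (intro integral_mono_AE integrable_mult_right one_particleD(2) z Mz)
  then show "\<rho>\<^sup>2 * normsq ?z \<le> h * D"
    using le by (simp add: normsq_def)
qed

text \<open>Every spin component of the residual has this form, with \<open>c\<close> a component of
  \<open>a_E\<close> and \<open>w\<close> the components of its images under the Pauli matrices.
  That \<open>T\<close> is chosen before \<open>h\<close>, \<open>q\<close>, \<open>p\<close> and
  \<open>a\<close> expresses the uniformity.\<close>

lemma fock_norm_field_combination_le: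
  fixes x :: "'n::finite \<Rightarrow> real^3" and c :: complex and w :: "'n \<times> 3 \<Rightarrow> complex"
  assumes chi: "schwartz chi" and cutoff: "eventually (\<lambda>r. chi r = 0) (nhds 0)"
  shows "\<exists>T. \<forall>h q p a. 0 < h \<longrightarrow> h < 1 \<longrightarrow> norm a = 1 \<longrightarrow> stationary chi x \<beta> h q p (pi_fun a) \<longrightarrow>
    (fock_norm (\<lambda>n K. c * H_ph h (coherent h q p) n K + complex_of_real h *
      (\<Sum>r\<in>UNIV. w r * B_op chi h (x (fst r)) (snd r) (coherent h q p) n K)))\<^sup>2 \<le> h ^ 3 * T"
proof -
  obtain \<rho> where \<rho>: "\<rho> > 0" "\<And>r. \<bar>r\<bar> < \<rho> \<Longrightarrow> chi r = 0"
    using cutoff by (auto simp: eventually_nhds_metric dist_real_def)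
  let ?f = "spin_coupling chi x"
  note f = spin_coupling_one_particle[OF chi, of x]
  define S where "S = (\<Sum>r\<in>UNIV. normsq (?f r))"
  \<comment> \<open>\<open>D\<close> bounds the squared norm of the weighted coupling for every unit
    spin state, and \<open>Z\<close> bounds \<open>|z|^2\<close> for \<open>h < 1\<close>, where
    \<open>\<rho>\<close> is the radius of the infrared cutoff. \<open>G\<close> then bounds the
    weighted scalar products with z.\<close>
  define D where "D = (\<Sum>r\<in>UNIV. (\<Sum>s\<in>UNIV. \<Sum>t\<in>UNIV. cmod (pauli_at (snd r) (fst r :: 'n) $ s $ t))\<^sup>2) * S"
  define Z where "Z = D / \<rho>\<^sup>2"
  define W where "W = (\<Sum>r\<in>UNIV. (cmod (w r))\<^sup>2)"
  define G where "G = (\<Sum>r\<in>UNIV. cmod (w r) * (normsq (?f r) + Z))"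
  have S: "S \<ge> 0" and W: "W \<ge> 0"
    by (auto simp: S_def W_def intro: sum_nonneg)
  have D: "D \<ge> 0"
    unfolding D_def using S by (intro mult_nonneg_nonneg sum_nonneg) auto
  then have Z: "Z \<ge> 0"
    by (simp add: Z_def)
  have "(fock_norm (\<lambda>n K. c * H_ph h (coherent h q p) n K + complex_of_real h *
      (\<Sum>r\<in>UNIV. w r * B_op chi h (x (fst r)) (snd r) (coherent h q p) n K)))\<^sup>2
      \<le> h ^ 3 * (G\<^sup>2 + 2 * (2 * ((cmod c)\<^sup>2 * D) + W * S) * (1 + Z))"
    if h: "0 < h" "h < 1" and a: "norm a = 1" and st: "stationary chi x \<beta> h q p (pi_fun a)" for h q p a
  proof -
    have dom: "q \<in> dom_mult_norm" "p \<in> dom_mult_norm"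
      using st by (auto simp: stationary_def)
    then have qp: "q \<in> photon_space" "p \<in> photon_space"
      by (auto simp: dom_mult_norm_def)
    let ?z = "amplitude h q p"
    let ?\<kappa> = "complex_of_real (coherent_weight h q p)"
    let ?s = "complex_of_real h * complex_of_real (sqrt h / sqrt 2)"
    note Mz = mode_mult_amplitude_one_particle[OF dom, of h]
    note z = amplitude_one_particle[OF qp, of h]
    \<comment> \<open>The factor \<open>h\<close> of the interaction and the \<open>sqrt h\<close>
      of the field give the third power on squaring, before anything is known about z.\<close>
    have cs: "(cmod ?s)\<^sup>2 = h ^ 3 / 2"
      using h by (simp add: norm_mult norm_divide power_mult_distrib power_divide power2_eq_square power3_eq_cube)
    have "(\<Sum>r\<in>UNIV. (pi_fun a (i_pauli_at (snd r) (fst r)))\<^sup>2) * (\<Sum>r\<in>UNIV. normsq (?f r)) \<le> D"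
      unfolding D_def S_def[symmetric]
    proof (intro mult_right_mono sum_mono S)
      fix r :: "'n \<times> 3"
      show "(pi_fun a (i_pauli_at (snd r) (fst r)))\<^sup>2
          \<le> (\<Sum>s\<in>UNIV. \<Sum>t\<in>UNIV. cmod (pauli_at (snd r) (fst r) $ s $ t))\<^sup>2"
        unfolding abs_le_square_iff[symmetric]
        by (rule order_trans[OF abs_pi_fun_i_pauli_at_le[OF a] abs_ge_self])
    qed
    note bounds = stationary_amplitude_bounds[OF chi \<rho>(2,1) st h(1) this]
    have Mz_le: "normsq (mode_mult ?z) \<le> h * D"
      using bounds(1) .
    \<comment> \<open>Here \<open>h < 1\<close> turns a bound of order \<open>h\<close> into a
      uniform one, which is all that the field terms ask of z.\<close>
    have "\<rho>\<^sup>2 * normsq ?z \<le> 1 * D"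
      using h D by (intro order_trans[OF bounds(2)] mult_right_mono) auto
    then have z_le: "normsq ?z \<le> Z"
      using \<rho>(1) by (simp add: Z_def field_simps)
    \<comment> \<open>\<open>\<gamma>\<close> collects the annihilation parts, \<open>g1\<close> the
      free photon term and \<open>g2\<close> the creation parts; \<open>g1\<close> and
      \<open>g2\<close> are both created and can be added.\<close>
    define \<gamma> where "\<gamma> = ?s * (\<Sum>r\<in>UNIV. w r * mode_inner (?f r) ?z)"
    define g1 where "g1 = (\<lambda>v. (c * complex_of_real h) * mode_mult ?z v)"
    define g2 where "g2 = (\<lambda>v. ?s * (\<Sum>r\<in>UNIV. w r * ?f r v))"
    have g: "g1 \<in> one_particle" "g2 \<in> one_particle" "(\<lambda>v. g1 v + g2 v) \<in> one_particle"
      unfolding g1_def g2_def by (intro one_particle_add one_particle_scale one_particle_sum Mz f)+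
    have e: "exp_vec ?z \<in> fock_space"
      by (rule exp_vec_fock_space[OF z])
    have eq: "(\<lambda>n K. c * H_ph h (coherent h q p) n K + complex_of_real h *
        (\<Sum>r\<in>UNIV. w r * B_op chi h (x (fst r)) (snd r) (coherent h q p) n K))
        = fock_scale ?\<kappa> (\<lambda>n K. fock_scale \<gamma> (exp_vec ?z) n K + creation (\<lambda>v. g1 v + g2 v) (exp_vec ?z) n K)"
    proof (intro ext)
      fix n K
      let ?C = "\<lambda>f. creation f (exp_vec ?z) n K"
      have H: "H_ph h (coherent h q p) n K = ?\<kappa> * (complex_of_real h * ?C (mode_mult ?z))"
        by (simp add: coherent_eq[OF h(1)] H_ph_fock_scale H_ph_exp_vec) (simp add: fock_scale_def)
      have B: "B_op chi h (x (fst r)) (snd r) (coherent h q p) n K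
          = ?\<kappa> * (complex_of_real (sqrt h / sqrt 2) * (mode_inner (?f r) ?z * exp_vec ?z n K + ?C (?f r)))" for r
        unfolding coherent_eq[OF h(1)] B_op_fock_scale
        by (simp add: fock_scale_def B_op_exp_vec spin_coupling_def case_prod_unfold)
      have C: "creation (\<lambda>v. g1 v + g2 v) (exp_vec ?z) n K
          = (c * complex_of_real h) * ?C (mode_mult ?z) + ?s * (\<Sum>r\<in>UNIV. w r * ?C (?f r))"
        unfolding creation_add_left g1_def g2_def creation_scale_left creation_sum ..
      have collect: "(\<Sum>r\<in>UNIV. w r * (y * (t * (m r * e + d r))))
          = y * (t * ((\<Sum>r\<in>UNIV. w r * m r) * e)) + y * (t * (\<Sum>r\<in>UNIV. w r * d r))"
        for m d :: "'n \<times> 3 \<Rightarrow> complex" and y t e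
        by (simp add: sum_distrib_left sum_distrib_right sum.distrib algebra_simps)
      show "c * H_ph h (coherent h q p) n K + complex_of_real h *
          (\<Sum>r\<in>UNIV. w r * B_op chi h (x (fst r)) (snd r) (coherent h q p) n K)
        = fock_scale ?\<kappa> (\<lambda>n K. fock_scale \<gamma> (exp_vec ?z) n K + creation (\<lambda>v. g1 v + g2 v) (exp_vec ?z) n K) n K"
        unfolding H B fock_scale_def \<gamma>_def C collect by (simp only: distrib_left mult_ac add_ac)
    qed
    have "cmod (\<Sum>r\<in>UNIV. w r * mode_inner (?f r) ?z) \<le> G"
      unfolding G_def
    proof (rule order_trans[OF norm_sum], intro sum_mono)
      fix r
      have "cmod (mode_inner (?f r) ?z) \<le> normsq (?f r) + Z"
        using cmod_mode_inner_le[OF f[of r] z] z_le by linarith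
      then show "cmod (w r * mode_inner (?f r) ?z) \<le> cmod (w r) * (normsq (?f r) + Z)"
        unfolding norm_mult by (rule mult_left_mono) simp
    qed
    then have "(cmod (\<Sum>r\<in>UNIV. w r * mode_inner (?f r) ?z))\<^sup>2 \<le> G\<^sup>2"
      by (rule power_mono) simp
    then have \<gamma>: "(cmod \<gamma>)\<^sup>2 \<le> h ^ 3 / 2 * G\<^sup>2"
      unfolding \<gamma>_def norm_mult[of ?s] power_mult_distrib cs using h by (intro mult_left_mono) auto
    \<comment> \<open>Two powers of \<open>h\<close> come from the prefactor of \<open>H_ph\<close>,
      the third from the bound on Mz.\<close>
    have "normsq g1 = (cmod c)\<^sup>2 * h\<^sup>2 * normsq (mode_mult ?z)"
      unfolding g1_def by (simp add: normsq_scale[OF Mz] norm_mult power_mult_distrib)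
    also have "\<dots> \<le> (cmod c)\<^sup>2 * h\<^sup>2 * (h * D)"
      by (rule mult_left_mono[OF Mz_le]) simp
    also have "\<dots> = h ^ 3 * ((cmod c)\<^sup>2 * D)"
      by (simp add: power2_eq_square power3_eq_cube)
    finally have g1: "normsq g1 \<le> h ^ 3 * ((cmod c)\<^sup>2 * D)" .
    have "normsq g2 = h ^ 3 / 2 * normsq (\<lambda>v. \<Sum>r\<in>UNIV. w r * ?f r v)"
      unfolding g2_def normsq_scale[OF one_particle_sum[OF f]] cs ..
    also have "\<dots> \<le> h ^ 3 / 2 * (W * S)"
      unfolding W_def S_def using h by (intro mult_left_mono normsq_sum_le f) auto
    finally have g2: "normsq g2 \<le> h ^ 3 / 2 * (W * S)" .
    have g12: "normsq (\<lambda>v. g1 v + g2 v) \<le> h ^ 3 * (2 * ((cmod c)\<^sup>2 * D) + W * S)"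
      using normsq_add_le[OF g(1,2)] g1 g2 by (simp add: distrib_left)
    have "(fock_norm (\<lambda>n K. fock_scale \<gamma> (exp_vec ?z) n K + creation (\<lambda>v. g1 v + g2 v) (exp_vec ?z) n K))\<^sup>2
        \<le> 2 * (fock_norm (fock_scale \<gamma> (exp_vec ?z)))\<^sup>2 + 2 * (fock_norm (creation (\<lambda>v. g1 v + g2 v) (exp_vec ?z)))\<^sup>2"
      by (intro fock_norm_add_le fock_space_scale creation_exp_vec_fock_space e g z)
    also have "\<dots> \<le> 2 * ((cmod \<gamma>)\<^sup>2 * exp (normsq ?z))
        + 2 * (normsq (\<lambda>v. g1 v + g2 v) * ((1 + normsq ?z) * exp (normsq ?z)))"
      using fock_norm_creation_exp_vec_le[OF g(3) z]
      by (simp add: fock_norm_scale[OF e] fock_norm_exp_vec[OF z])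
    also have "\<dots> = (2 * (cmod \<gamma>)\<^sup>2 + 2 * (normsq (\<lambda>v. g1 v + g2 v) * (1 + normsq ?z))) * exp (normsq ?z)"
      by (simp add: algebra_simps)
    also have "\<dots> \<le> (2 * (h ^ 3 / 2 * G\<^sup>2) + 2 * (h ^ 3 * (2 * ((cmod c)\<^sup>2 * D) + W * S) * (1 + Z))) * exp (normsq ?z)"
      using g12 \<gamma> z_le h D S W
      by (intro mult_right_mono add_mono mult_left_mono mult_mono) auto
    also have "\<dots> = h ^ 3 * (G\<^sup>2 + 2 * (2 * ((cmod c)\<^sup>2 * D) + W * S) * (1 + Z)) * exp (normsq ?z)"
      by (simp add: algebra_simps)
    finally have "(cmod ?\<kappa>)\<^sup>2 * (fock_norm (\<lambda>n K. fock_scale \<gamma> (exp_vec ?z) n K + creation (\<lambda>v. g1 v + g2 v) (exp_vec ?z) n K))\<^sup>2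
        \<le> (cmod ?\<kappa>)\<^sup>2 * (h ^ 3 * (G\<^sup>2 + 2 * (2 * ((cmod c)\<^sup>2 * D) + W * S) * (1 + Z)) * exp (normsq ?z))"
      by (rule mult_left_mono) simp
    also have "(cmod ?\<kappa>)\<^sup>2 = exp (- normsq ?z)"
      using coherent_weight_square[OF h(1) qp] by simp
    also have "exp (- normsq ?z) * (h ^ 3 * (G\<^sup>2 + 2 * (2 * ((cmod c)\<^sup>2 * D) + W * S) * (1 + Z)) * exp (normsq ?z))
        = h ^ 3 * (G\<^sup>2 + 2 * (2 * ((cmod c)\<^sup>2 * D) + W * S) * (1 + Z))"
      by (simp add: exp_minus)
    finally show ?thesis
      unfolding eq
      by (subst fock_norm_scale)
        (auto intro!: fock_space_add fock_space_scale creation_exp_vec_fock_space e g z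
          simp: coherent_weight_square[OF h(1) qp])
  qed
  then show ?thesis
    by blast
qed

text \<open>The spin coordinates of a product vector are multiples of one Fock vector, so
  homogeneity of \<open>A\<close> lets the operator act factor by factor.\<close>

lemma op_tensor_full_tensor:
  assumes "\<And>c. A (fock_scale c \<Psi>) = fock_scale c (A \<Psi>)"
  shows "op_tensor A S (full_tensor \<Psi> v) s n K = (S *v v) $ s * A \<Psi> n K"
  by (simp add: op_tensor_def full_tensor_def assms matrix_vector_mult_def sum_distrib_right mult.assoc)
    (simp add: fock_scale_def mult.assoc)

text \<open>The magnetic term is kept apart from the fields because on \<open>a_E\<close> it is the
  scalar that the eigenvalue removes.\<close>

lemma full_hamiltonian_full_tensor:
  fixes x :: "'n::finite \<Rightarrow> real^3"
  shows "full_hamiltonian chi x \<beta> h (full_tensor \<Psi> v) s n K = v $ s * H_ph h \<Psi> n K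
    + complex_of_real h * ((\<Sum>l\<in>UNIV. \<Sum>m\<in>UNIV. complex_of_real (\<beta> $ m) * (pauli_at m l *v v) $ s) * \<Psi> n K)
    + complex_of_real h * (\<Sum>r\<in>UNIV. (pauli_at (snd r) (fst r) *v v) $ s * B_op chi h (x (fst r)) (snd r) \<Psi> n K)"
proof -
  have field: "op_tensor (\<lambda>\<Psi> n K. complex_of_real (\<beta> $ m) * \<Psi> n K + B_op chi h (x l) m \<Psi> n K) S (full_tensor \<Psi> v) s n K
      = (S *v v) $ s * (complex_of_real (\<beta> $ m) * \<Psi> n K + B_op chi h (x l) m \<Psi> n K)" for l m and S :: "'n spin_mat"
    by (rule op_tensor_full_tensor) (simp add: B_op_fock_scale, simp add: fock_scale_def fun_eq_iff algebra_simps)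
  show ?thesis
    unfolding full_hamiltonian_def field op_tensor_full_tensor[of "H_ph h", OF H_ph_fock_scale] sum_sum_UNIV
    by (simp add: distrib_left sum.distrib sum_distrib_left sum_distrib_right mult_ac)
qed

theorem proposition6p4:
  fixes chi :: "real \<Rightarrow> real" and x :: "'n::finite \<Rightarrow> real^3" and \<beta> :: "real^3"
  assumes "schwartz chi" and "eventually (\<lambda>r. chi r = 0) (nhds 0)"
  shows "(\<forall>h>0. \<forall>q\<in>photon_space. \<forall>p\<in>photon_space. \<forall>a::complex^('n \<Rightarrow> 2).
            norm a = 1 \<longrightarrow> stationary chi x \<beta> h q p (pi_fun a) \<longrightarrow>
            coherent h q p \<in> sum_dom chi x h \<and>
            fock_eq (averaged_op chi x \<beta> h a (coherent h q p))
              (fock_scale (complex_of_real (hamiltonian_fun chi x \<beta> h q p (pi_fun a)))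
                (coherent h q p)))
       \<and>
       (\<beta> \<noteq> 0 \<longrightarrow> (\<forall>b0 b1 :: complex^2. \<forall>E::'n set.
            norm b0 = 1 \<longrightarrow> norm b1 = 1 \<longrightarrow>
            (\<Sum>m\<in>UNIV. \<beta> $ m *\<^sub>R (pauli m *v b0)) = - norm \<beta> *\<^sub>R b0 \<longrightarrow>
            (\<Sum>m\<in>UNIV. \<beta> $ m *\<^sub>R (pauli m *v b1)) = norm \<beta> *\<^sub>R b1 \<longrightarrow>
            (\<exists>C>0. \<forall>h. 0 < h \<and> h < 1 \<longrightarrow>
              (\<forall>q\<in>photon_space. \<forall>p\<in>photon_space. \<forall>a::complex^('n \<Rightarrow> 2).
                norm a = 1 \<longrightarrow> stationary chi x \<beta> h q p (pi_fun a) \<longrightarrow>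
                (let \<Phi> = full_tensor (coherent h q p) (spin_conf_vec b0 b1 E) in
                  \<Phi> \<in> dom_full_hamiltonian chi x h \<and>
                  full_norm (\<lambda>s n K. full_hamiltonian chi x \<beta> h \<Phi> s n K -
                      complex_of_real ((2 * real (card E) - real CARD('n)) * norm \<beta> * h) * \<Phi> s n K)
                    \<le> C * h powr (3/2))))))"
proof (intro conjI allI ballI impI)
  fix h q p and a :: "complex^('n \<Rightarrow> 2)"
  assume h: "0 < h" and st: "stationary chi x \<beta> h q p (pi_fun a)"
  then show "coherent h q p \<in> sum_dom chi x h"
    by (intro coherent_sum_dom assms) (auto simp: stationary_def)
  show "fock_eq (averaged_op chi x \<beta> h a (coherent h q p))
      (fock_scale (complex_of_real (hamiltonian_fun chi x \<beta> h q p (pi_fun a))) (coherent h q p))"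
    by (rule averaged_op_coherent[OF assms(1) st h])
next
  fix b0 b1 :: "complex^2" and E :: "'n set"
  assume b: "(\<Sum>m\<in>UNIV. \<beta> $ m *\<^sub>R (pauli m *v b0)) = - norm \<beta> *\<^sub>R b0"
    "(\<Sum>m\<in>UNIV. \<beta> $ m *\<^sub>R (pauli m *v b1)) = norm \<beta> *\<^sub>R b1"
  let ?v = "spin_conf_vec b0 b1 E"
  let ?ev = "(2 * real (card E) - real CARD('n)) * norm \<beta>"
  let ?R = "\<lambda>h q p s n K. ?v $ s * H_ph h (coherent h q p) n K + complex_of_real h *
    (\<Sum>r\<in>UNIV. (pauli_at (snd r) (fst r) *v ?v) $ s * B_op chi h (x (fst r)) (snd r) (coherent h q p) n K)"
  define P where "P = (\<lambda>s T. \<forall>h q p a. 0 < h \<longrightarrow> h < 1 \<longrightarrow> norm a = 1 \<longrightarrow>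
      stationary chi x \<beta> h q p (pi_fun a) \<longrightarrow> (fock_norm (?R h q p s))\<^sup>2 \<le> h ^ 3 * T)"
  \<comment> \<open>One constant for each spin configuration; there are finitely many, so summing
    them is harmless.\<close>
  have "\<exists>T. P s T" for s
    unfolding P_def by (rule fock_norm_field_combination_le[OF assms])
  then obtain T where "\<And>s. P s (T s)"
    by metis
  then have T: "(fock_norm (?R h q p s))\<^sup>2 \<le> h ^ 3 * T s"
    if "0 < h" "h < 1" "norm a = 1" "stationary chi x \<beta> h q p (pi_fun a)" for s h q p and a :: "complex^('n \<Rightarrow> 2)"
    using that unfolding P_def by blast
  \<comment> \<open>The absolute values avoid a discussion of the sign of \<open>T s\<close>, and
    the added 1 keeps \<open>C\<close> positive even if all \<open>T s\<close> vanish.\<close>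
  define C where "C = sqrt (\<Sum>s\<in>UNIV. \<bar>T s\<bar>) + 1"
  show "\<exists>C>0. \<forall>h. 0 < h \<and> h < 1 \<longrightarrow>
      (\<forall>q\<in>photon_space. \<forall>p\<in>photon_space. \<forall>a::complex^('n \<Rightarrow> 2).
        norm a = 1 \<longrightarrow> stationary chi x \<beta> h q p (pi_fun a) \<longrightarrow>
        (let \<Phi> = full_tensor (coherent h q p) ?v in \<Phi> \<in> dom_full_hamiltonian chi x h \<and>
          full_norm (\<lambda>s n K. full_hamiltonian chi x \<beta> h \<Phi> s n K - complex_of_real (?ev * h) * \<Phi> s n K)
            \<le> C * h powr (3/2)))"
  proof (intro exI[of _ C] conjI allI ballI impI)
    show "C > 0"
      unfolding C_def by (intro add_nonneg_pos real_sqrt_ge_zero sum_nonneg) auto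
    fix h q p and a :: "complex^('n \<Rightarrow> 2)"
    assume "0 < h \<and> h < 1" and a: "norm a = 1" and st: "stationary chi x \<beta> h q p (pi_fun a)"
    then have h: "0 < h" "h < 1"
      by auto
    have mem: "coherent h q p \<in> sum_dom chi x h"
      using st by (intro coherent_sum_dom assms h) (auto simp: stationary_def)
    have dom: "full_tensor (coherent h q p) ?v \<in> dom_full_hamiltonian chi x h"
      using mem by (simp add: dom_full_hamiltonian_def full_tensor_def sum_dom_def op_dom_def
          H_ph_fock_scale B_op_fock_scale fock_space_scale)
    have R: "full_hamiltonian chi x \<beta> h (full_tensor (coherent h q p) ?v) s n K
        - complex_of_real (?ev * h) * full_tensor (coherent h q p) ?v s n K = ?R h q p s n K" for s n K
      unfolding full_hamiltonian_full_tensor spin_conf_vec_eigen[OF b]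
      by (simp add: full_tensor_def fock_scale_def)
    have "(\<Sum>s\<in>UNIV. (fock_norm (?R h q p s))\<^sup>2) \<le> (\<Sum>s\<in>UNIV. h ^ 3 * \<bar>T s\<bar>)"
    proof (rule sum_mono)
      fix s
      show "(fock_norm (?R h q p s))\<^sup>2 \<le> h ^ 3 * \<bar>T s\<bar>"
        by (rule order_trans[OF T[OF h a st]]) (intro mult_left_mono, use h in auto)
    qed
    then have "full_norm (?R h q p) \<le> sqrt (h ^ 3 * (\<Sum>s\<in>UNIV. \<bar>T s\<bar>))"
      unfolding full_norm_def sum_distrib_left by (rule real_sqrt_le_mono)
    also have "\<dots> = sqrt (h ^ 3) * sqrt (\<Sum>s\<in>UNIV. \<bar>T s\<bar>)"
      by (rule real_sqrt_mult)
    also have "sqrt (h ^ 3) = h powr (3/2)"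
    proof -
      have "h powr (3/2) = (h powr 3) powr (1/2)"
        by (simp add: powr_powr)
      then show ?thesis
        using h by (simp add: powr_half_sqrt)
    qed
    also have "h powr (3/2) * sqrt (\<Sum>s\<in>UNIV. \<bar>T s\<bar>) \<le> h powr (3/2) * C"
      unfolding C_def by (intro mult_left_mono) auto
    finally show "let \<Phi> = full_tensor (coherent h q p) ?v in \<Phi> \<in> dom_full_hamiltonian chi x h \<and>
        full_norm (\<lambda>s n K. full_hamiltonian chi x \<beta> h \<Phi> s n K - complex_of_real (?ev * h) * \<Phi> s n K)
          \<le> C * h powr (3/2)"
      unfolding Let_def R using dom by (simp only: mult.commute simp_thms)
  qed
qed

end
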